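(* For all $z$ in the upper half plane, $$\Delta_{4,7}(z)=\frac{\eta^5(z)\eta^5(7z)}{\eta(2z)\eta(14z)}+4\,\eta^2(z)\eta^2(2z)\eta^2(7z)\eta^2(14z).$$
   Context: Let $q=e^{2\pi i z}$ with $\mathrm{Im}(z)>0$ and let $\eta(z)=q^{1/24}\prod_{n\ge1}(1-q^n)$ be the Dedekind eta function. The form $\Delta_{4,7}$ is defined by $$\Delta_{4,7}(z)=\left(\eta^{16}(z)\eta^8(7z)+13\,\eta^{12}(z)\eta^{12}(7z)+49\,\eta^8(z)\eta^{16}(7z)\right)^{1/3},$$ where the cube root is understood as a power series in $q$: with $F(q)=\prod_{n\ge1}(1-q^n)$, $$\Delta_{4,7}(z)=q\left(F^{16}(q)F^8(q^7)+13q\,F^{12}(q)F^{12}(q^7)+49q^2F^8(q)F^{16}(q^7)\right)^{1/3},$$ the cube root of the power series (which has constant term $1$) being the one with constant term $1$. *)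

theory Defs
  imports "HOL-Analysis.Analysis"
begin

definition nome :: "complex \<Rightarrow> complex" where
  "nome z = exp (2 * of_real pi * \<i> * z)"

text \<open>The factor \<open>q\<^sup>1\<^sup>/\<^sup>2\<^sup>4\<close> is \<open>exp (2 \<pi> \<i> z / 24)\<close>, not a principal power of \<open>q\<close>.\<close>

definition dedekind_eta :: "complex \<Rightarrow> complex" where
  "dedekind_eta z = exp (2 * of_real pi * \<i> * z / 24) * (\<Prod>n. 1 - nome z ^ (n + 1))"

text \<open>\<open>F(q)\<close> as a formal power series: the infinite product is taken in the
  \<open>X\<close>-adic topology of \<^typ>\<open>complex fps\<close>.\<close>

definition eta_fps :: "complex fps" where
  "eta_fps = (\<Prod>n. 1 - fps_X ^ (n + 1))"

definition Delta47_cube_fps :: "complex fps" where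
  "Delta47_cube_fps =
     (let F = eta_fps; F7 = eta_fps oo fps_X ^ 7 in
        F ^ 16 * F7 ^ 8
        + 13 * fps_X * F ^ 12 * F7 ^ 12
        + 49 * fps_X ^ 2 * F ^ 8 * F7 ^ 16)"

definition fps_cube_root :: "complex fps \<Rightarrow> complex fps" where
  "fps_cube_root G = (THE g. g ^ 3 = G \<and> fps_nth g 0 = 1)"

definition Delta47 :: "complex \<Rightarrow> complex" where
  "Delta47 z = nome z * eval_fps (fps_cube_root Delta47_cube_fps) (nome z)"


text \<open>The infinite product and the cube root above are well-defined.\<close>

lemma fps_nth_prod_1_minus_X_power:
  assumes "n \<le> m"
  shows "fps_nth (\<Prod>i\<le>m. 1 - fps_X ^ (i + 1) :: complex fps) n
       = fps_nth (\<Prod>i\<le>n. 1 - fps_X ^ (i + 1) :: complex fps) n"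
  using assms
proof (induction m rule: dec_induct)
  case (step m)
  have "fps_nth (P * fps_X ^ (Suc m + 1)) n = 0" for P :: "complex fps"
    using step.hyps by (simp only: fps_X_power_mult_right_nth) simp
  hence "fps_nth (\<Prod>i\<le>Suc m. 1 - fps_X ^ (i + 1) :: complex fps) n
       = fps_nth (\<Prod>i\<le>m. 1 - fps_X ^ (i + 1) :: complex fps) n"
    by (simp only: prod.atMost_Suc right_diff_distrib mult_1_right fps_sub_nth) simp
  with step.IH show ?case
    by (rule trans[rotated])
qed (rule refl)

lemma eta_fps_has_prod: "(\<lambda>n. 1 - fps_X ^ (n + 1)) has_prod eta_fps"
proof -
  define P :: "nat \<Rightarrow> complex fps" where "P = (\<lambda>m. \<Prod>i\<le>m. 1 - fps_X ^ (i + 1))"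
  define F where "F = Abs_fps (\<lambda>n. fps_nth (P n) n)"
  have "P \<longlonglongrightarrow> F"
    unfolding tendsto_fps_iff
  proof
    fix n
    show "\<forall>\<^sub>F m in sequentially. fps_nth (P m) n = fps_nth F n"
      using eventually_ge_at_top[of n]
      unfolding F_def P_def fps_nth_Abs_fps
      by eventually_elim (rule fps_nth_prod_1_minus_X_power)
  qed
  moreover have "fps_nth F 0 = 1"
    by (simp add: F_def P_def)
  hence "F \<noteq> 0" by auto
  ultimately have "(\<lambda>n. 1 - fps_X ^ (n + 1)) has_prod F"
    unfolding has_prod_def raw_has_prod_def P_def add_0_right by blast
  moreover from this have "eta_fps = F"
    unfolding eta_fps_def by (rule has_prod_unique[symmetric])
  ultimately show ?thesis by simp
qed

lemma eta_fps_nth_0: "fps_nth eta_fps 0 = 1"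
proof -
  have "\<not> (1 - fps_X ^ (n + 1) :: complex fps) = 0" for n
  proof
    assume "(1 - fps_X ^ (n + 1) :: complex fps) = 0"
    hence "fps_nth (1 - fps_X ^ (n + 1) :: complex fps) 0 = 0" by simp
    thus False by simp
  qed
  hence "(\<lambda>m. \<Prod>i\<le>m. 1 - fps_X ^ (i + 1)) \<longlonglongrightarrow> eta_fps"
    using eta_fps_has_prod unfolding has_prod_def raw_has_prod_def by auto
  hence "\<forall>\<^sub>F m in sequentially.
           fps_nth (\<Prod>i\<le>m. 1 - fps_X ^ (i + 1) :: complex fps) 0 = fps_nth eta_fps 0"
    by (simp only: tendsto_fps_iff)
  then obtain m where
    "fps_nth (\<Prod>i\<le>m. 1 - fps_X ^ (i + 1) :: complex fps) 0 = fps_nth eta_fps 0"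
    using eventually_happens'[OF sequentially_bot] by blast
  thus ?thesis
    using fps_nth_prod_1_minus_X_power[of 0 m] by simp
qed

lemma Delta47_cube_fps_nth_0: "fps_nth Delta47_cube_fps 0 = 1"
  by (simp add: Delta47_cube_fps_def Let_def eta_fps_nth_0 fps_power_zeroth mult.assoc)

lemma fps_cube_root_ex1:
  fixes G :: "complex fps"
  assumes "fps_nth G 0 = 1"
  shows "\<exists>!g. g ^ 3 = G \<and> fps_nth g 0 = 1"
proof -
  define r :: "nat \<Rightarrow> complex \<Rightarrow> complex" where "r = (\<lambda>_ _. 1)"
  have "g ^ Suc 2 = G \<longleftrightarrow> g = fps_radical r (Suc 2) G" if "fps_nth g 0 = 1" for g
    by (rule radical_unique) (use that assms in \<open>simp_all add: r_def\<close>)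
  moreover have "Suc 2 = 3" by simp
  ultimately have "g ^ 3 = G \<longleftrightarrow> g = fps_radical r 3 G" if "fps_nth g 0 = 1" for g
    using that by metis
  moreover have "fps_nth (fps_radical r 3 G) 0 = 1"
    by (simp add: r_def)
  ultimately show ?thesis by blast
qed

lemma fps_cube_root_Delta47:
  "fps_cube_root Delta47_cube_fps ^ 3 = Delta47_cube_fps"
  "fps_nth (fps_cube_root Delta47_cube_fps) 0 = 1"
  using theI'[OF fps_cube_root_ex1[OF Delta47_cube_fps_nth_0]]
  unfolding fps_cube_root_def by blast+

end

(*
  Write f_k for f(q^k), F for the Euler product, A = F F_7, and B = A_2, E = A_4.

  (1) The pentagonal number theorem and arithmetic of the form x^2 + 7 y^2 give
      A(-q) = A + 2 q E. As A(q) A(-q) E = B^3, this is the relation B^3 = A^2 E + 2 q A E^2.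
  (2) Let L = 1 + 2 sum_n (sum_{d | n} (d/7)) q^n. A bijection on solutions of a x + b y = n gives
      L^2 = 1 + 4 (S - 7 S_7) with S = sum_n sigma(n) q^n, which is minus the logarithmic
      derivative of t = F^4 / (q F_7^4). Both L and L^2 are Hecke eigenfunctions at 2, so L(q) + L(-q)
      and L(q) L(-q) are polynomials in L_2 and L_4, and this determines L. By (1), the series
      A^2 / B + 4 q B^2 / A satisfies the same equations, hence is equal to L.
  (3) With u = A^3 / (q B^3), (1) and (2) give L^3 / (q A^3) = Y for Y = (u + 4)^3 / u^2, and
      Y_2 = (u + 2)^3 / u. These formulas imply that (q Y')^2 / (L^4 (Y + 1) (Y - 27)) is invariant
      under q -> q^2, hence is equal to 1. By (2), t + 13 + 49 / t satisfies the same differential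
      equation, so it is Y. Thus A^3 L is the cube root of the series in the definition of Delta.
*)
theory Submission
  imports Defs "HOL-Computational_Algebra.Formal_Laurent_Series"
begin

unbundle no vec_syntax
unbundle fps_syntax

section \<open>Operators on power series\<close>

text \<open>Modularity is replaced by uniqueness: a series is pinned down by equations under q ->
  q^2 or by a differential equation. The prime 2 enters because the right-hand side has level 14. It
  is a square modulo 7, so the eigenvalues of L and L^2 at 2 are 1 + 1 = 2 and 1 + 2 = 3. The cube
  root prevents a direct comparison; both sides are identified with q A^3 L, where L has explicit
  coefficients.

  The constants belong to the involutions t -> 49/t and u -> 8/u. With 13 one has Y + 1 = (t + 7)^2
  / t and Y - 27 = (t - 7)^2 / t, so (Y + 1) (Y - 27) = (t - 49/t)^2, and t - 49/t is what
  differentiating t + 49/t produces. The second involution turns (u + 4)^3 / u^2 into (u + 2)^3 / u.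
  Written in u, (Y + 1) (Y - 27) and its analogue for Y_2 share one polynomial factor; the rest is a
  power of u and the square of a factor of the derivative.

  As t, u and Y have a simple pole at q = 0, the power series q t, q u and q Y with constant term 1
  are used instead. A summand X next to them stands for the constant 1.\<close>

definition qderiv :: "complex fps \<Rightarrow> complex fps" where
  "qderiv f = fps_X * fps_deriv f"

definition dil :: "nat \<Rightarrow> complex fps \<Rightarrow> complex fps" where
  "dil k f = f oo fps_X ^ k"

definition alt :: "complex fps \<Rightarrow> complex fps" where
  "alt f = f oo - fps_X"

lemma qderiv_nth: "qderiv f $ n = of_nat n * f $ n"
  by (cases n) (simp_all add: qderiv_def)

lemma qderiv_add: "qderiv (f + g) = qderiv f + qderiv g"
  by (simp add: qderiv_def algebra_simps)

lemma qderiv_diff: "qderiv (f - g) = qderiv f - qderiv g"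
  by (simp add: qderiv_def algebra_simps)

lemma qderiv_mult: "qderiv (f * g) = qderiv f * g + f * qderiv g"
  by (simp add: qderiv_def algebra_simps)

lemma qderiv_power: "qderiv (f ^ Suc n) = of_nat (Suc n) * f ^ n * qderiv f"
  by (simp add: qderiv_def fps_deriv_power fps_of_nat del: power_Suc of_nat_Suc)

lemma qderiv_numeral [simp]: "qderiv (numeral k) = 0"
  by (simp add: qderiv_def)

lemma qderiv_1 [simp]: "qderiv 1 = 0"
  by (simp add: qderiv_def)

lemma qderiv_X [simp]: "qderiv fps_X = fps_X"
  by (simp add: qderiv_def)

lemma dil_nth: "k > 0 \<Longrightarrow> dil k f $ n = (if k dvd n then f $ (n div k) else 0)"
  unfolding dil_def by (simp add: fps_nth_compose_X_power)

lemma alt_nth: "alt f $ n = (-1) ^ n * f $ n"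
  unfolding alt_def by (simp add: fps_compose_uminus')

lemma dil_add: "dil k (f + g) = dil k f + dil k g"
  by (simp add: dil_def fps_compose_add_distrib)

lemma dil_diff: "dil k (f - g) = dil k f - dil k g"
  by (simp add: dil_def fps_compose_sub_distrib)

lemma dil_mult: "k > 0 \<Longrightarrow> dil k (f * g) = dil k f * dil k g"
  by (simp add: dil_def fps_compose_mult_distrib)

lemma dil_power: "k > 0 \<Longrightarrow> dil k (f ^ n) = dil k f ^ n"
  by (simp add: dil_def fps_compose_power)

lemma dil_numeral [simp]: "dil k (numeral n) = numeral n"
  by (simp add: dil_def numeral_fps_const)

lemma dil_1 [simp]: "dil k 1 = 1"
  by (simp add: dil_def)

lemma dil_X: "k > 0 \<Longrightarrow> dil k fps_X = fps_X ^ k"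
  by (simp add: dil_def)

lemma dil_dil: "j > 0 \<Longrightarrow> k > 0 \<Longrightarrow> dil j (dil k f) = dil (j * k) f"
  by (rule fps_ext)
     (auto simp: dil_nth div_mult2_eq dvd_div_iff_mult mult.commute dest: dvd_mult_left dvd_mult_right)

lemma dil_alt: "k > 0 \<Longrightarrow> even k \<Longrightarrow> alt (dil k f) = dil k f"
  by (rule fps_ext) (auto simp: alt_nth dil_nth)

lemma alt_add: "alt (f + g) = alt f + alt g"
  by (simp add: alt_def fps_compose_add_distrib)

lemma alt_mult: "alt (f * g) = alt f * alt g"
  by (simp add: alt_def fps_compose_mult_distrib)

lemma alt_power: "alt (f ^ n) = alt f ^ n"
  by (simp add: alt_def fps_compose_power)

lemma alt_numeral [simp]: "alt (numeral n) = numeral n"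
  by (simp add: alt_def numeral_fps_const)

lemma alt_X [simp]: "alt fps_X = - fps_X"
  by (simp add: alt_def)

lemma dil_uminus: "dil k (- f) = - dil k f"
  by (simp add: dil_def fps_compose_uminus)

lemma alt_uminus: "alt (- f) = - alt f"
  by (simp add: alt_def fps_compose_uminus)

lemma alt_diff: "alt (f - g) = alt f - alt g"
  by (simp add: alt_def fps_compose_sub_distrib)

lemma alt_1 [simp]: "alt 1 = 1"
  by (simp add: alt_def)

lemma alt_dil_odd: "odd k \<Longrightarrow> alt (dil k f) = dil k (alt f)"
  by (rule fps_ext) (auto simp: alt_nth dil_nth power_mult odd_pos elim!: dvdE)

lemma qderiv_dil: "k > 0 \<Longrightarrow> qderiv (dil k f) = of_nat k * dil k (qderiv f)"
  by (rule fps_ext) (auto simp: qderiv_nth dil_nth fps_of_nat[symmetric] elim!: dvdE)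

lemma qderiv_alt: "qderiv (alt f) = alt (qderiv f)"
  by (rule fps_ext) (simp add: qderiv_nth alt_nth)

lemma dil_nth_0 [simp]: "dil k f $ 0 = f $ 0"
  by (simp add: dil_def)

lemma alt_nth_0 [simp]: "alt f $ 0 = f $ 0"
  by (simp add: alt_def)

lemma qderiv_nth_0 [simp]: "qderiv f $ 0 = 0"
  by (simp add: qderiv_nth)

text \<open>\<open>h\<close> is the common logarithmic derivative, hence \<open>f / g\<close> has
  derivative 0. Product identities thus become linear identities between divisor sums.\<close>

lemma fps_eq_if_qderiv_eq:
  assumes "qderiv f = f * h" "qderiv g = g * h" "f $ 0 = g $ 0" "g $ 0 \<noteq> 0"
  shows "f = g"
proof -
  have "(f * inverse g) * g = f"
    using assms(4) by (simp add: inverse_mult_eq_1 mult.assoc)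
  moreover have "fps_deriv (f * inverse g) = 0"
  proof -
    have "qderiv (f * inverse g) * g + (f * inverse g) * qderiv g = qderiv f"
      using \<open>(f * inverse g) * g = f\<close> qderiv_mult by metis
    hence "qderiv (f * inverse g) * g = qderiv f - (f * inverse g) * g * h"
      using assms(2) by (simp add: algebra_simps)
    also have "\<dots> = 0"
      using \<open>(f * inverse g) * g = f\<close> assms(1) by simp
    finally show ?thesis using assms(4) by (auto simp: qderiv_def)
  qed
  hence "f * inverse g = fps_const ((f * inverse g) $ 0)"
    by (simp only: fps_deriv_eq_0_iff)
  hence "f * inverse g = 1" using assms(3,4) by simp
  ultimately show ?thesis by simp
qed

section \<open>The Euler product\<close>

lemma eta_fps_nth:
  assumes "n \<le> m"
  shows "eta_fps $ n = (\<Prod>i\<le>m. 1 - fps_X ^ (i + 1)) $ n"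
proof -
  have "(1 - fps_X ^ (n + 1) :: complex fps) \<noteq> 0" for n
  proof
    assume "(1 - fps_X ^ (n + 1) :: complex fps) = 0"
    hence "(1 - fps_X ^ (n + 1) :: complex fps) $ 0 = 0" by simp
    thus False by simp
  qed
  hence "(\<lambda>m. \<Prod>i\<le>m. 1 - fps_X ^ (i + 1)) \<longlonglongrightarrow> eta_fps"
    using eta_fps_has_prod unfolding has_prod_def raw_has_prod_def by auto
  hence "\<forall>\<^sub>F m in sequentially. (\<Prod>i\<le>m. 1 - fps_X ^ (i + 1) :: complex fps) $ n = eta_fps $ n"
    by (simp only: tendsto_fps_iff)
  then obtain M where "\<And>m. m \<ge> M \<Longrightarrow> (\<Prod>i\<le>m. 1 - fps_X ^ (i + 1) :: complex fps) $ n = eta_fps $ n"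
    unfolding eventually_sequentially by blast
  from this[of "max M n"] show ?thesis
    using fps_nth_prod_1_minus_X_power[of n "max M n"] fps_nth_prod_1_minus_X_power[OF assms] by simp
qed

section \<open>Divisor sums and the logarithmic derivative of the Euler product\<close>

definition divisor_sum :: "(nat \<Rightarrow> int) \<Rightarrow> nat \<Rightarrow> int" where
  "divisor_sum g n = (if n = 0 then 0 else \<Sum>d | d dvd n. g d)"

text \<open>The Lambert series with terms g(d) q^d / (1 - q^d); the convention at
  \<open>n = 0\<close> makes its constant term 0.\<close>

definition divisor_fps :: "(nat \<Rightarrow> int) \<Rightarrow> complex fps" where
  "divisor_fps g = Abs_fps (\<lambda>n. of_int (divisor_sum g n))"

lemma divisor_fps_nth: "divisor_fps g $ n = of_int (divisor_sum g n)"
  by (simp add: divisor_fps_def)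

lemma qderiv_one_minus_X_power:
  assumes "d > 0"
  shows "qderiv (1 - fps_X ^ d) =
         - (1 - fps_X ^ d) * Abs_fps (\<lambda>n. if n > 0 \<and> d dvd n then of_nat d else 0)"
proof -
  let ?g = "Abs_fps (\<lambda>n. if n > 0 \<and> d dvd n then of_nat d else 0) :: complex fps"
  have "(1 - fps_X ^ d) * ?g = ?g - fps_X ^ d * ?g" by (simp add: algebra_simps)
  also have "\<dots> = of_nat d * fps_X ^ d"
    using assms by (auto simp: fps_eq_iff fps_X_power_mult_nth fps_of_nat[symmetric] dvd_minus_self)
  finally have "(1 - fps_X ^ d) * ?g = of_nat d * fps_X ^ d" .
  moreover have "qderiv (1 - fps_X ^ d) = - (of_nat d * fps_X ^ d)"
    by (rule fps_ext) (auto simp: qderiv_nth fps_of_nat[symmetric])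
  ultimately show ?thesis by (simp only: mult_minus_left)
qed

text \<open>The factor 1 - q^d has the logarithmic derivative - d q^d / (1 - q^d). The coefficient
  at \<open>n\<close> sees only the partial product \<open>P n\<close>, so no limit has to be
  interchanged with the derivative.\<close>

lemma qderiv_eta_fps: "qderiv eta_fps = - eta_fps * divisor_fps int"
proof (rule fps_ext)
  fix n
  define P :: "nat \<Rightarrow> complex fps" where "P m = (\<Prod>i\<le>m. 1 - fps_X ^ (i + 1))" for m
  define g :: "nat \<Rightarrow> complex fps"
    where "g d = Abs_fps (\<lambda>n. if n > 0 \<and> d dvd n then of_nat d else 0)" for d
  have P: "qderiv (P m) = - P m * (\<Sum>i\<le>m. g (i + 1))" for m
  proof (induction m)
    case 0
    show ?case using qderiv_one_minus_X_power[of 1] by (simp add: P_def g_def cong: if_cong)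
  next
    case (Suc m)
    have P_Suc: "P (Suc m) = P m * (1 - fps_X ^ (Suc m + 1))"
      by (simp add: P_def)
    hence "qderiv (P (Suc m)) = qderiv (P m) * (1 - fps_X ^ (Suc m + 1))
             + P m * qderiv (1 - fps_X ^ (Suc m + 1))"
      by (simp only: qderiv_mult)
    also have "\<dots> = - P (Suc m) * (\<Sum>i\<le>Suc m. g (i + 1))"
      unfolding Suc.IH using qderiv_one_minus_X_power[of "Suc m + 1", folded g_def]
      by (simp only: P_Suc sum.atMost_Suc) (simp add: algebra_simps)
    finally show ?case .
  qed
  have g: "(\<Sum>i\<le>n. g (i + 1)) $ k = divisor_fps int $ k" if "k \<le> n" for k
  proof (cases "k = 0")
    case False
    have "(\<Sum>i\<le>n. g (i + 1)) $ k = (\<Sum>i\<le>n. if (i + 1) dvd k then of_nat (i + 1) else 0)"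
      using False by (simp only: fps_sum_nth g_def fps_nth_Abs_fps) simp
    also have "\<dots> = (\<Sum>i\<in>{i\<in>{..n}. (i + 1) dvd k}. of_nat (i + 1))"
      by (simp add: sum.If_cases Int_def)
    also have "\<dots> = (\<Sum>d | d dvd k. of_nat d)"
      by (rule sum.reindex_bij_witness[of _ "\<lambda>d. d - 1" "\<lambda>i. i + 1"])
         (use False that in \<open>auto dest: dvd_imp_le simp: Suc_le_eq intro!: Nat.gr0I\<close>)
    finally show ?thesis using False by (simp add: divisor_fps_nth divisor_sum_def)
  qed (simp add: fps_sum_nth g_def divisor_fps_nth divisor_sum_def)
  have "qderiv eta_fps $ n = qderiv (P n) $ n"
    using eta_fps_nth[of n n] by (simp add: qderiv_nth P_def)
  also have "\<dots> = - (\<Sum>i=0..n. P n $ i * (\<Sum>i\<le>n. g (i + 1)) $ (n - i))"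
    by (simp add: P fps_mult_nth)
  also have "(\<Sum>i=0..n. P n $ i * (\<Sum>i\<le>n. g (i + 1)) $ (n - i))
           = (\<Sum>i=0..n. eta_fps $ i * divisor_fps int $ (n - i))"
    by (intro sum.cong refl arg_cong2[where f = times])
       (simp_all only: g P_def eta_fps_nth[of _ n] diff_le_self atLeastAtMost_iff)
  finally show "qderiv eta_fps $ n = (- eta_fps * divisor_fps int) $ n"
    by (simp add: fps_mult_nth)
qed

section \<open>The pentagonal number theorem\<close>

definition sgn_parity :: "int \<Rightarrow> 'a :: comm_ring_1" where
  "sgn_parity m = (if even m then 1 else - 1)"

definition pentagonal :: "int \<Rightarrow> nat" where
  "pentagonal m = nat (m * (3 * m - 1) div 2)"

lemma even_pentagonal: "even (m * (3 * m - 1) :: int)"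
  by simp

lemma int_pentagonal: "2 * int (pentagonal m) = m * (3 * m - 1)"
proof -
  have "m * (3 * m - 1) \<ge> 0"
    by (cases "m \<ge> 1") (auto intro: mult_nonneg_nonneg mult_nonpos_nonpos)
  thus ?thesis using even_pentagonal[of m] by (auto simp: pentagonal_def)
qed

text \<open>A crude bound that suffices: it makes the fibres of \<open>pentagonal\<close> finite and
  later bounds the coefficients of the Euler product linearly.\<close>

lemma abs_le_pentagonal: "\<bar>m\<bar> \<le> int (pentagonal m)"
proof -
  have "2 * \<bar>m\<bar> \<le> m * (3 * m - 1)"
  proof (cases "m \<ge> 1")
    case True
    have "m * 2 \<le> m * (3 * m - 1)" using True by (intro mult_left_mono) auto
    thus ?thesis using True by simp
  next
    case False
    have "(- m) * 2 \<le> (- m) * (1 - 3 * m)" if "m < 0" using that by (intro mult_left_mono) auto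
    moreover have "m < 0 \<or> m = 0" using False by auto
    ultimately show ?thesis by (auto simp: algebra_simps)
  qed
  thus ?thesis using int_pentagonal[of m] by linarith
qed

text \<open>Shanks' finite form of the pentagonal number theorem. In the step, consecutive
  left-hand sides differ by a telescoping sum of the terms \<open>V k\<close>.\<close>

lemma shanks_pentagonal:
  fixes q :: "'a :: comm_ring_1"
  shows "(\<Sum>k\<le>n. (-1) ^ k * (\<Prod>i\<in>{k<..n}. 1 - q ^ i) * q ^ (k * n + \<Sum>{..k}))
     = (\<Sum>m\<in>{- int n..int n}. sgn_parity m * q ^ pentagonal m)"
proof (induction n)
  case 0
  show ?case by (simp add: pentagonal_def sgn_parity_def)
next
  case (Suc n)
  define Q :: "nat \<Rightarrow> nat \<Rightarrow> 'a" where "Q n k = (\<Prod>i\<in>{k<..n}. 1 - q ^ i)" for n k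
  define W :: "nat \<Rightarrow> nat \<Rightarrow> 'a"
    where "W n k = (-1) ^ k * Q n k * q ^ (k * n + \<Sum>{..k})" for n k
  define V :: "nat \<Rightarrow> 'a"
    where "V k = (-1) ^ k * Q n k * q ^ (k * n + \<Sum>{..k} + n + 1 + k)" for k
  have Q_Suc: "Q (Suc n) k = Q n k * (1 - q ^ Suc n)" if "k \<le> n" for k
  proof -
    have "{k<..Suc n} = insert (Suc n) {k<..n}" using that by auto
    thus ?thesis by (simp add: Q_def mult.commute)
  qed
  have Q_pred: "Q n k = Q n (Suc k) * (1 - q ^ Suc k)" if "k < n" for k
  proof -
    have "{k<..n} = insert (Suc k) {Suc k<..n}" using that by auto
    thus ?thesis by (simp add: Q_def mult.commute)
  qed
  have step: "W (Suc n) k = W n k - V k + (if k = 0 then 0 else V (k - 1))" if "k \<le> n" for k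
  proof (cases k)
    case 0
    show ?thesis using Q_Suc[of 0] by (simp add: 0 W_def V_def algebra_simps)
  next
    case (Suc j)
    have e1: "q ^ (Suc j * Suc n + \<Sum>{..Suc j}) = q ^ (Suc j * n + \<Sum>{..Suc j}) * (q ^ Suc j :: 'a)"
      unfolding power_add[symmetric] by (simp add: algebra_simps)
    have e2: "q ^ (Suc j * n + \<Sum>{..Suc j} + n + 1 + Suc j)
      = q ^ (Suc j * n + \<Sum>{..Suc j}) * q ^ Suc j * (q ^ Suc n :: 'a)"
      unfolding power_add[symmetric] by (simp add: algebra_simps)
    have e3: "q ^ (j * n + \<Sum>{..j} + n + 1 + j) = (q ^ (Suc j * n + \<Sum>{..Suc j}) :: 'a)"
      by (simp add: algebra_simps)
    have "Suc j \<le> n" using that Suc by simp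
    hence q: "Q (Suc n) (Suc j) = Q n (Suc j) * (1 - q ^ Suc n)"
      "Q n j = Q n (Suc j) * (1 - q ^ Suc j)"
      by (rule Q_Suc, intro Q_pred) simp
    have k: "(if k = 0 then 0 else V (k - 1)) = V j" using Suc by simp
    show ?thesis
      unfolding k unfolding Suc W_def V_def q e1 e2 e3 power_Suc[of "-1"]
      by (simp only: algebra_simps mult_minus_left mult_minus_right mult_1_left mult_1_right
            add_minus_cancel minus_add_cancel)
  qed
  have "(\<Sum>k\<le>n. W (Suc n) k) = (\<Sum>k\<le>n. W n k - V k + (if k = 0 then 0 else V (k - 1)))"
    by (rule sum.cong) (simp_all add: step)
  also have "\<dots> = (\<Sum>k\<le>n. W n k) - (\<Sum>k\<le>n. V k - (if k = 0 then 0 else V (k - 1)))"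
    by (simp add: sum.distrib sum_subtractf)
  also have "(\<Sum>k\<le>m. V k - (if k = 0 then 0 else V (k - 1))) = V m" for m
    by (induction m) auto
  finally have W: "(\<Sum>k\<le>Suc n. W (Suc n) k) = (\<Sum>k\<le>n. W n k) - V n + W (Suc n) (Suc n)"
    by simp
  have tri: "2 * int (\<Sum>{..k}) = int k * (int k + 1)" for k
    by (induction k) (simp_all add: algebra_simps)
  \<comment> \<open>The end \<open>- V n\<close> of the telescope and the new term k = n + 1 are the
    two summands still missing on the right, m = n + 1 and m = - (n + 1).\<close>
  have "int (pentagonal (int (Suc n))) = int (n * n + \<Sum>{..n} + n + 1 + n)"
    using tri[of n] int_pentagonal[of "int (Suc n)"] by (simp add: algebra_simps)
  hence p1: "pentagonal (int (Suc n)) = n * n + \<Sum>{..n} + n + 1 + n"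
    by (simp only: of_nat_eq_iff)
  have "int (pentagonal (- int (Suc n))) = int (Suc n * Suc n + \<Sum>{..Suc n})"
    using tri[of n] int_pentagonal[of "- int (Suc n)"] by (simp add: algebra_simps)
  hence p2: "pentagonal (- int (Suc n)) = Suc n * Suc n + \<Sum>{..Suc n}"
    by (simp only: of_nat_eq_iff)
  have s: "sgn_parity (int (Suc n)) = - ((-1) ^ n :: 'a)"
    "sgn_parity (- int (Suc n)) = ((-1) ^ Suc n :: 'a)"
    by (simp_all add: sgn_parity_def)
  have "- V n = sgn_parity (int (Suc n)) * q ^ pentagonal (int (Suc n))"
    unfolding p1 s V_def by (simp add: Q_def)
  moreover have "W (Suc n) (Suc n) = sgn_parity (- int (Suc n)) * q ^ pentagonal (- int (Suc n))"
    unfolding p2 s W_def by (simp add: Q_def)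
  moreover have "{- int (Suc n)..int (Suc n)} = insert (int (Suc n)) (insert (- int (Suc n)) {- int n..int n})"
    by auto
  ultimately show ?case
    using W Suc.IH by (simp add: W_def Q_def)
qed

lemma eta_fps_nth_pentagonal: "eta_fps $ k = (\<Sum>m | pentagonal m = k. sgn_parity m)"
proof -
  \<comment> \<open>Since \<open>n > k\<close>, all terms of the finite identity with
    \<open>j > 0\<close> are divisible by X^n and do not reach the coefficient \<open>k\<close>;
    only the partial product remains.\<close>
  define n where "n = Suc k"
  define T :: "nat \<Rightarrow> complex fps"
    where "T j = (-1) ^ j * (\<Prod>i\<in>{j<..n}. 1 - fps_X ^ i) * fps_X ^ (j * n + \<Sum>{..j})" for j
  have T: "T j $ k = 0" if "j > 0" for j
  proof -
    have "n * 1 \<le> n * j" using that by (intro mult_left_mono) auto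
    hence "k < j * n + \<Sum>{..j}" by (simp add: n_def mult.commute)
    thus ?thesis by (simp add: T_def fps_X_power_mult_right_nth)
  qed
  have "(\<Prod>i\<in>{0<..n}. 1 - fps_X ^ i) = (\<Prod>i\<le>k. 1 - fps_X ^ (i + 1) :: complex fps)"
    by (rule prod.reindex_bij_witness[of _ "\<lambda>i. i + 1" "\<lambda>i. i - 1"]) (auto simp: n_def)
  hence "eta_fps $ k = T 0 $ k"
    by (simp add: T_def eta_fps_nth[of k k])
  also have "\<dots> = (\<Sum>j\<in>{0}. T j $ k)" by simp
  also have "\<dots> = (\<Sum>j\<le>n. T j $ k)"
    by (rule sum.mono_neutral_left) (auto simp: T)
  also have "\<dots> = (\<Sum>j\<le>n. T j) $ k" by (simp add: fps_sum_nth)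
  also have "(\<Sum>j\<le>n. T j) = (\<Sum>m\<in>{- int n..int n}. sgn_parity m * fps_X ^ pentagonal m)"
    unfolding T_def by (rule shanks_pentagonal)
  also have "\<dots> $ k = (\<Sum>m\<in>{- int n..int n}. if pentagonal m = k then sgn_parity m else 0)"
    unfolding fps_sum_nth by (rule sum.cong) (auto simp: sgn_parity_def)
  also have "\<dots> = (\<Sum>m\<in>{m \<in> {- int n..int n}. pentagonal m = k}. sgn_parity m)"
    by (simp add: sum.If_cases Int_def)
  also have "{m \<in> {- int n..int n}. pentagonal m = k} = {m. pentagonal m = k}"
  proof (intro equalityI subsetI)
    fix m assume "m \<in> {m. pentagonal m = k}"
    thus "m \<in> {m \<in> {- int n..int n}. pentagonal m = k}"
      using abs_le_pentagonal[of m] by (auto simp: n_def)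
  qed auto
  finally show ?thesis .
qed

lemma finite_pentagonal_eq: "finite {m. pentagonal m = k}"
proof (rule finite_subset)
  show "{m. pentagonal m = k} \<subseteq> {- int k..int k}"
  proof
    fix m assume "m \<in> {m. pentagonal m = k}"
    thus "m \<in> {- int k..int k}" using abs_le_pentagonal[of m] by auto
  qed
qed simp

section \<open>The quadratic form $x^2 + 7y^2$\<close>

text \<open>With x = 6 m - 1 and y = 6 n - 1 the condition reads x^2 + 7 y^2 = 24 N + 8.\<close>

definition septic_pairs :: "nat \<Rightarrow> (int \<times> int) set" where
  "septic_pairs N = {(m, n). pentagonal m + 7 * pentagonal n = N}"

lemma finite_septic_pairs: "finite (septic_pairs N)"
proof (rule finite_subset)
  show "septic_pairs N \<subseteq> {- int N..int N} \<times> {- int N..int N}"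
  proof clarify
    fix m n assume "(m, n) \<in> septic_pairs N"
    thus "m \<in> {- int N..int N} \<and> n \<in> {- int N..int N}"
      using abs_le_pentagonal[of m] abs_le_pentagonal[of n] by (auto simp: septic_pairs_def)
  qed
qed simp

definition eta_septic :: "complex fps" where
  "eta_septic = eta_fps * dil 7 eta_fps"

lemma eta_septic_nth: "eta_septic $ N = (\<Sum>(m, n)\<in>septic_pairs N. sgn_parity (m + n))"
proof -
  have dil: "dil 7 eta_fps $ k = (\<Sum>n | 7 * pentagonal n = k. sgn_parity n)" for k
  proof (cases "7 dvd k")
    case True
    then obtain j where "k = 7 * j" ..
    thus ?thesis by (simp add: dil_nth eta_fps_nth_pentagonal)
  next
    case False
    hence "{n. 7 * pentagonal n = k} = {}" by auto
    thus ?thesis using False by (simp only: dil_nth) simp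
  qed
  have fin: "finite {n. 7 * pentagonal n = k}" for k
  proof -
    have "{n. 7 * pentagonal n = k} \<subseteq> {m. pentagonal m = k div 7}" by auto
    thus ?thesis using finite_pentagonal_eq finite_subset by blast
  qed
  have "eta_septic $ N = (\<Sum>i=0..N. \<Sum>m | pentagonal m = i. \<Sum>n | 7 * pentagonal n = N - i.
          sgn_parity m * sgn_parity n)"
    by (simp add: eta_septic_def fps_mult_nth dil eta_fps_nth_pentagonal sum_product)
  also have "\<dots> = (\<Sum>(i, m, n)\<in>(SIGMA i:{0..N}. {m. pentagonal m = i} \<times> {n. 7 * pentagonal n = N - i}).
          sgn_parity m * sgn_parity n)"
    by (subst sum.Sigma[symmetric])
       (auto simp: sum.cartesian_product[symmetric] fin finite_pentagonal_eq)
  also have "\<dots> = (\<Sum>(m, n)\<in>septic_pairs N. sgn_parity m * sgn_parity n)"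
    by (rule sum.reindex_bij_witness[of _ "\<lambda>(m, n). (pentagonal m, m, n)" "\<lambda>(i, m, n). (m, n)"])
       (auto simp: septic_pairs_def)
  also have "\<dots> = (\<Sum>(m, n)\<in>septic_pairs N. sgn_parity (m + n))"
    by (rule sum.cong) (auto simp: sgn_parity_def)
  finally show ?thesis .
qed

lemma septic_pairs_iff:
  "(m, n) \<in> septic_pairs N \<longleftrightarrow> m * (3 * m - 1) + 7 * (n * (3 * n - 1)) = 2 * int N"
  using int_pentagonal[of m] int_pentagonal[of n] unfolding septic_pairs_def by simp linarith

lemma eta_septic_nth_parts:
  "eta_septic $ N = of_nat (card {(m, n) \<in> septic_pairs N. even (m + n)})
                  - of_nat (card {(m, n) \<in> septic_pairs N. odd (m + n)})"
proof -
  have "eta_septic $ N = (\<Sum>p\<in>septic_pairs N. if even (fst p + snd p) then 1 else - 1)"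
    unfolding eta_septic_nth by (rule sum.cong) (auto simp: sgn_parity_def)
  also have "\<dots> = (\<Sum>p\<in>septic_pairs N \<inter> {p. even (fst p + snd p)}. 1)
      + (\<Sum>p\<in>septic_pairs N \<inter> - {p. even (fst p + snd p)}. - 1)"
    by (rule sum.If_cases) (rule finite_septic_pairs)
  also have "septic_pairs N \<inter> {p. even (fst p + snd p)} = {(m, n) \<in> septic_pairs N. even (m + n)}"
    by auto
  also have "septic_pairs N \<inter> - {p. even (fst p + snd p)} = {(m, n) \<in> septic_pairs N. odd (m + n)}"
    by auto
  finally show ?thesis by (simp add: sum_negf)
qed

text \<open>If \<open>m (3m - 1) / 2 + 7 n (3n - 1) / 2\<close> is odd, then \<open>m = 4i + 2 - 3n\<close> or \<open>m = 4i + 1 + 3n\<close>,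
  according to the parity of \<open>m + n\<close>. Substitution gives the two polynomials.\<close>

definition form_even :: "int \<Rightarrow> int \<Rightarrow> int" where
  "form_even i n = 24 * i\<^sup>2 + 22 * i + 5 - 36 * i * n - 20 * n + 24 * n\<^sup>2"

definition form_odd :: "int \<Rightarrow> int \<Rightarrow> int" where
  "form_odd i n = 24 * i\<^sup>2 + 10 * i + 1 + 36 * i * n + 4 * n + 24 * n\<^sup>2"

lemma card_even_septic_pairs:
  assumes "odd N"
  shows "card {(m, n) \<in> septic_pairs N. even (m + n)} = card {(i, n). form_even i n = int N}"
proof (rule bij_betw_same_card[OF bij_betw_byWitness[where f' = "\<lambda>(i, n). (4 * i + 2 - 3 * n, n)"]])
  let ?f = "\<lambda>(m, n). ((m + 3 * n - 2) div 4, n)"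
  have *: "\<exists>i. m = 4 * i + 2 - 3 * n \<and> form_even i n = int N"
    if "(m, n) \<in> septic_pairs N" "even (m + n)" for m n
  proof -
    have "even (m + 3 * n)" using that(2) by simp
    then obtain j where j: "m = 2 * j - 3 * n" by (metis add_diff_cancel_right' evenE)
    have eq: "6 * j\<^sup>2 - 18 * j * n - j + 24 * n\<^sup>2 - 2 * n = int N"
      using that(1) unfolding septic_pairs_iff j by (simp add: power2_eq_square algebra_simps)
    have "odd j"
    proof
      assume "even j"
      hence "even (6 * j\<^sup>2 - 18 * j * n - j + 24 * n\<^sup>2 - 2 * n)" by simp
      with eq assms show False by simp
    qed
    then obtain i where i: "j = 2 * i + 1" by (elim oddE)
    show ?thesis using eq j unfolding i form_even_def
      by (intro exI[of _ i]) (simp add: power2_eq_square algebra_simps)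
  qed
  show "\<forall>p\<in>{(m, n) \<in> septic_pairs N. even (m + n)}. (\<lambda>(i, n). (4 * i + 2 - 3 * n, n)) (?f p) = p"
    using * by fastforce
  show "\<forall>p\<in>{(i, n). form_even i n = int N}. ?f ((\<lambda>(i, n). (4 * i + 2 - 3 * n, n)) p) = p"
    by auto
  show "?f ` {(m, n) \<in> septic_pairs N. even (m + n)} \<subseteq> {(i, n). form_even i n = int N}"
    using * by fastforce
  show "(\<lambda>(i, n). (4 * i + 2 - 3 * n, n)) ` {(i, n). form_even i n = int N}
          \<subseteq> {(m, n) \<in> septic_pairs N. even (m + n)}"
    by (auto simp: septic_pairs_iff form_even_def power2_eq_square algebra_simps)
qed

lemma card_odd_septic_pairs:
  assumes "odd N"
  shows "card {(m, n) \<in> septic_pairs N. odd (m + n)} = card {(i, n). form_odd i n = int N}"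
proof (rule bij_betw_same_card[OF bij_betw_byWitness[where f' = "\<lambda>(i, n). (3 * n + 1 + 4 * i, n)"]])
  let ?f = "\<lambda>(m, n). ((m - 3 * n - 1) div 4, n)"
  have *: "\<exists>i. m = 3 * n + 1 + 4 * i \<and> form_odd i n = int N"
    if "(m, n) \<in> septic_pairs N" "odd (m + n)" for m n
  proof -
    have "even (m - 3 * n - 1)" using that(2) by simp
    then obtain j where "m - 3 * n - 1 = 2 * j" by (elim evenE)
    hence j: "m = 2 * j + 3 * n + 1" by simp
    have eq: "6 * j\<^sup>2 + 18 * j * n + 5 * j + 24 * n\<^sup>2 + 4 * n + 1 = int N"
      using that(1) unfolding septic_pairs_iff j by (simp add: power2_eq_square algebra_simps)
    have "even j"
    proof (rule ccontr)
      assume "odd j"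
      hence "even (6 * j\<^sup>2 + 18 * j * n + 5 * j + 24 * n\<^sup>2 + 4 * n + 1)" by simp
      with eq assms show False by simp
    qed
    then obtain i where i: "j = 2 * i" by (elim evenE)
    show ?thesis using eq j unfolding i form_odd_def
      by (intro exI[of _ i]) (simp add: power2_eq_square algebra_simps)
  qed
  show "\<forall>p\<in>{(m, n) \<in> septic_pairs N. odd (m + n)}. (\<lambda>(i, n). (3 * n + 1 + 4 * i, n)) (?f p) = p"
    using * by fastforce
  show "\<forall>p\<in>{(i, n). form_odd i n = int N}. ?f ((\<lambda>(i, n). (3 * n + 1 + 4 * i, n)) p) = p"
    by auto
  show "?f ` {(m, n) \<in> septic_pairs N. odd (m + n)} \<subseteq> {(i, n). form_odd i n = int N}"
    using * by fastforce
  show "(\<lambda>(i, n). (3 * n + 1 + 4 * i, n)) ` {(i, n). form_odd i n = int N}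
          \<subseteq> {(m, n) \<in> septic_pairs N. odd (m + n)}"
    by (auto simp: septic_pairs_iff form_odd_def power2_eq_square algebra_simps)
qed

lemma eta_septic_nth_odd:
  assumes "odd N"
  shows "eta_septic $ N = of_nat (card {(i, n). form_even i n = int N})
                        - of_nat (card {(i, n). form_odd i n = int N})"
  by (simp only: eta_septic_nth_parts card_even_septic_pairs[OF assms] card_odd_septic_pairs[OF assms])

text \<open>An odd \<open>N\<close> thus fixes the parity of \<open>i\<close> by its residue modulo
  4: odd for residue 3, even for residue 1.\<close>

lemma form_mod_4: "form_even i n mod 4 = (2 * i + 1) mod 4" "form_odd i n mod 4 = (2 * i + 1) mod 4"
proof -
  have "form_even i n = 2 * i + 1 + 4 * (6 * i\<^sup>2 + 5 * i + 1 - 9 * i * n - 5 * n + 6 * n\<^sup>2)"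
    "form_odd i n = 2 * i + 1 + 4 * (6 * i\<^sup>2 + 2 * i + 9 * i * n + n + 6 * n\<^sup>2)"
    by (simp_all add: form_even_def form_odd_def algebra_simps)
  thus "form_even i n mod 4 = (2 * i + 1) mod 4" "form_odd i n mod 4 = (2 * i + 1) mod 4"
    by (simp_all only: mod_mult_self2)
qed

text \<open>For fixed \<open>i\<close> the two forms are quadratics in \<open>n\<close> that differ
  by a shift of (3 i + 1) / 2. The shift is integral exactly for odd \<open>i\<close>, and then
  solutions of opposite sign cancel.\<close>

lemma eta_septic_nth_mod_4_eq_3:
  assumes "N mod 4 = 3"
  shows "eta_septic $ N = 0"
proof -
  have "odd N" using assms by presburger
  have odd: "odd i" if "(2 * i + 1) mod 4 = int N mod 4" for i
    using that assms by presburger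
  have ie: "odd i" if "form_even i n = int N" for i n
    using form_mod_4(1)[of i n] that odd by metis
  have io: "odd i" if "form_odd i n = int N" for i n
    using form_mod_4(2)[of i n] that odd by metis
  have eq: "form_odd i (n - (3 * i + 1) div 2) = form_even i n" if "odd i" for i n
  proof -
    from that obtain j where "i = 2 * j + 1" by (elim oddE)
    hence "(3 * i + 1) div 2 = 3 * j + 2" "i = 2 * j + 1" by auto
    thus ?thesis unfolding form_even_def form_odd_def by (simp add: power2_eq_square algebra_simps)
  qed
  have "card {(i, n). form_even i n = int N} = card {(i, n). form_odd i n = int N}"
  proof (rule bij_betw_same_card[OF bij_betw_byWitness[where f' = "\<lambda>(i, n). (i, n + (3 * i + 1) div 2)"]])
    let ?f = "\<lambda>(i, n). (i, n - (3 * i + 1) div 2)" and ?g = "\<lambda>(i, n). (i, n + (3 * i + 1) div 2)"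
    show "\<forall>p\<in>{(i, n). form_even i n = int N}. ?g (?f p) = p" by auto
    show "\<forall>p\<in>{(i, n). form_odd i n = int N}. ?f (?g p) = p" by auto
    show "?f ` {(i, n). form_even i n = int N} \<subseteq> {(i, n). form_odd i n = int N}"
      using eq ie by auto
    show "?g ` {(i, n). form_odd i n = int N} \<subseteq> {(i, n). form_even i n = int N}"
      using eq[symmetric] io by auto
  qed
  thus ?thesis by (simp only: eta_septic_nth_odd[OF \<open>odd N\<close>]) simp
qed

text \<open>The form is the norm \<open>(6m - 1)\<^sup>2 + 7 (6n - 1)\<^sup>2\<close>, up to an affine change. The bijections are
  multiplication by the elements \<open>(\<plusminus>3 \<plusminus> \<surd>-7) / 2\<close> of norm \<open>4\<close>.\<close>

lemma eta_septic_nth_mod_4_eq_1: "eta_septic $ (4 * M + 1) = - (eta_septic $ M)"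
proof -
  have even: "\<exists>j. i = 2 * j" if "(2 * i + 1) mod 4 = int (4 * M + 1) mod 4" for i
  proof -
    have "even i" using that by presburger
    thus ?thesis by (elim evenE) blast
  qed
  have ie: "\<exists>j. i = 2 * j" if "form_even i n = int (4 * M + 1)" for i n
    using form_mod_4(1)[of i n] that even by metis
  have io: "\<exists>j. i = 2 * j" if "form_odd i n = int (4 * M + 1)" for i n
    using form_mod_4(2)[of i n] that even by metis
  \<comment> \<open>The norm is multiplied by 4 because 24 (4 M + 1) + 8 = 4 (24 M + 8). The
    correspondence exchanges even and odd \<open>m + n\<close>, which gives the minus sign.\<close>
  have "card {(i, n). form_even i n = int (4 * M + 1)} = card {(m, n) \<in> septic_pairs M. odd (m + n)}"
  proof (rule bij_betw_same_card[OF bij_betw_byWitness[where f' = "\<lambda>(a, b). (- 2 * b, (1 - 3 * b - a) div 2)"]])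
    let ?f = "\<lambda>(i, n). (1 + 3 * (i div 2) - 2 * n, - (i div 2))"
    let ?g = "\<lambda>(a, b). (- 2 * b, (1 - 3 * b - a) div 2)"
    have g: "\<exists>n. a = 1 - 3 * b - 2 * n" if "odd (a + b)" for a b :: int
    proof -
      have "even (1 - 3 * b - a)" using that by simp
      then obtain n where "1 - 3 * b - a = 2 * n" by (elim evenE)
      thus ?thesis by (intro exI[of _ n]) simp
    qed
    show "\<forall>p\<in>{(i, n). form_even i n = int (4 * M + 1)}. ?g (?f p) = p" using ie by fastforce
    show "\<forall>p\<in>{(m, n) \<in> septic_pairs M. odd (m + n)}. ?f (?g p) = p" using g by fastforce
    show "?f ` {(i, n). form_even i n = int (4 * M + 1)} \<subseteq> {(m, n) \<in> septic_pairs M. odd (m + n)}"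
    proof clarify
      fix i n assume a: "form_even i n = int (4 * M + 1)"
      then obtain j where i: "i = 2 * j" using ie by blast
      show "(1 + 3 * (i div 2) - 2 * n, - (i div 2)) \<in> septic_pairs M \<and> odd (1 + 3 * (i div 2) - 2 * n + - (i div 2))"
        using a unfolding septic_pairs_iff form_even_def i by (simp add: power2_eq_square algebra_simps)
    qed
    show "?g ` {(m, n) \<in> septic_pairs M. odd (m + n)} \<subseteq> {(i, n). form_even i n = int (4 * M + 1)}"
    proof clarify
      fix a b assume a: "(a, b) \<in> septic_pairs M" "odd (a + b)"
      then obtain n where n: "a = 1 - 3 * b - 2 * n" using g by blast
      show "form_even (- 2 * b) ((1 - 3 * b - a) div 2) = int (4 * M + 1)"
        using a(1) unfolding septic_pairs_iff form_even_def n by (simp add: power2_eq_square algebra_simps)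
    qed
  qed
  moreover have "card {(i, n). form_odd i n = int (4 * M + 1)} = card {(m, n) \<in> septic_pairs M. even (m + n)}"
  proof (rule bij_betw_same_card[OF bij_betw_byWitness[where f' = "\<lambda>(a, b). (- 2 * b, (3 * b - a) div 2)"]])
    let ?f = "\<lambda>(i, n). (- 3 * (i div 2) - 2 * n, - (i div 2))"
    let ?g = "\<lambda>(a, b). (- 2 * b, (3 * b - a) div 2)"
    have g: "\<exists>n. a = 3 * b - 2 * n" if "even (a + b)" for a b :: int
    proof -
      have "even (3 * b - a)" using that by simp
      then obtain n where "3 * b - a = 2 * n" by (elim evenE)
      thus ?thesis by (intro exI[of _ n]) simp
    qed
    show "\<forall>p\<in>{(i, n). form_odd i n = int (4 * M + 1)}. ?g (?f p) = p" using io by fastforce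
    show "\<forall>p\<in>{(m, n) \<in> septic_pairs M. even (m + n)}. ?f (?g p) = p" using g by fastforce
    show "?f ` {(i, n). form_odd i n = int (4 * M + 1)} \<subseteq> {(m, n) \<in> septic_pairs M. even (m + n)}"
    proof clarify
      fix i n assume a: "form_odd i n = int (4 * M + 1)"
      then obtain j where i: "i = 2 * j" using io by blast
      show "(- 3 * (i div 2) - 2 * n, - (i div 2)) \<in> septic_pairs M \<and> even (- 3 * (i div 2) - 2 * n + - (i div 2))"
        using a unfolding septic_pairs_iff form_odd_def i by (simp add: power2_eq_square algebra_simps)
    qed
    show "?g ` {(m, n) \<in> septic_pairs M. even (m + n)} \<subseteq> {(i, n). form_odd i n = int (4 * M + 1)}"
    proof clarify
      fix a b assume a: "(a, b) \<in> septic_pairs M" "even (a + b)"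
      then obtain n where n: "a = 3 * b - 2 * n" using g by blast
      show "form_odd (- 2 * b) ((3 * b - a) div 2) = int (4 * M + 1)"
        using a(1) unfolding septic_pairs_iff form_odd_def n by (simp add: power2_eq_square algebra_simps)
    qed
  qed
  moreover have odd: "odd (4 * M + 1)" by simp
  ultimately show ?thesis
    unfolding eta_septic_nth_odd[OF odd] eta_septic_nth_parts[of M] by simp
qed

text \<open>Equivalently, the odd part of A is - q A(q^4): the residue 3 modulo 4 contributes
  nothing, and the residue 1 returns A with the opposite sign.\<close>

lemma alt_eta_septic: "alt eta_septic = eta_septic + 2 * fps_X * dil 4 eta_septic"
proof (rule fps_ext)
  fix n :: nat
  have "even n \<or> n = 4 * (n div 4) + 1 \<or> n mod 4 = 3" for n :: nat by presburger
  from this[of n] consider "even n" | M where "n = 4 * M + 1" | "n mod 4 = 3" by blast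
  thus "alt eta_septic $ n = (eta_septic + 2 * fps_X * dil 4 eta_septic) $ n"
  proof cases
    case 1
    have "(2 * fps_X * dil 4 eta_septic) $ n = 0"
    proof (cases n)
      case (Suc k)
      with 1 have "\<not> 4 dvd k" by presburger
      thus ?thesis using Suc by (simp add: mult.assoc numeral_fps_const dil_nth)
    qed (simp add: mult.assoc)
    thus ?thesis using 1 by (simp add: alt_nth)
  next
    case 2
    have "(2 * fps_X * dil 4 eta_septic) $ n = 2 * eta_septic $ M"
      by (simp add: mult.assoc numeral_fps_const dil_nth 2)
    moreover have "eta_septic $ n = - (eta_septic $ M)"
      unfolding 2 by (rule eta_septic_nth_mod_4_eq_1)
    moreover have "odd n" using 2 by simp
    ultimately show ?thesis by (simp add: alt_nth)
  next
    case 3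
    then obtain k where k: "n = Suc k" by (cases n) auto
    have "\<not> 4 dvd k" using 3 k by presburger
    hence "(2 * fps_X * dil 4 eta_septic) $ n = 0"
      using k by (simp add: mult.assoc numeral_fps_const dil_nth)
    thus ?thesis using eta_septic_nth_mod_4_eq_3[OF 3] by (simp add: alt_nth)
  qed
qed

section \<open>The square of the Eisenstein series of weight one\<close>

definition legendre7 :: "nat \<Rightarrow> int" where
  "legendre7 a = (if a mod 7 \<in> {1, 2, 4} then 1 else if a mod 7 = 0 then 0 else - 1)"

text \<open>The value depends only on the triple of residues \<open>(a, b, - a - b)\<close>, up to order and sign:
  it is \<open>3\<close> on \<open>(1, 2, 4)\<close>, \<open>- 1\<close> on \<open>(a, a, - 2a)\<close> and \<open>- 5\<close> if some residue vanishes.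
  These values are chosen such that \<open>kernel7_diff\<close> holds.\<close>

definition kernel7 :: "nat \<Rightarrow> nat \<Rightarrow> int" where
  "kernel7 a b =
     (if 7 dvd a \<or> 7 dvd b \<or> 7 dvd (a + b) then - 5
      else if legendre7 a = legendre7 b \<and> legendre7 (a + b) \<noteq> legendre7 a then 3 else - 1)"

lemma legendre7_cong: "a mod 7 = b mod 7 \<Longrightarrow> legendre7 a = legendre7 b"
  by (simp add: legendre7_def)

lemma kernel7_cong:
  assumes "a mod 7 = a' mod 7" "b mod 7 = b' mod 7"
  shows "kernel7 a b = kernel7 a' b'"
proof -
  have ab: "(a + b) mod 7 = (a' + b') mod 7" using assms by (metis mod_add_cong)
  have "legendre7 a = legendre7 a'" "legendre7 b = legendre7 b'" "legendre7 (a + b) = legendre7 (a' + b')"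
    using assms ab by (auto intro: legendre7_cong)
  moreover have "7 dvd a \<longleftrightarrow> 7 dvd a'" "7 dvd b \<longleftrightarrow> 7 dvd b'" "7 dvd (a + b) \<longleftrightarrow> 7 dvd (a' + b')"
    using assms ab by (simp_all only: dvd_eq_mod_eq_0)
  ultimately show ?thesis by (simp only: kernel7_def)
qed

lemma kernel7_commute: "kernel7 a b = kernel7 b a"
  by (auto simp: kernel7_def add.commute)

lemma residue7_cases:
  fixes r :: nat
  assumes "r < 7"
  obtains "r = 0" | "r = 1" | "r = 2" | "r = 3" | "r = 4" | "r = 5" | "r = 6"
  using assms by linarith

text \<open>With b = a + c, the product of symbols becomes the difference of the kernel at (a, b)
  and at (a, b - a), the two ends of one subtractive Euclidean step. Only residues matter, so 49
  cases suffice.\<close>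

lemma kernel7_diff: "kernel7 a (a + c) - kernel7 a c = 4 * legendre7 a * legendre7 (a + c)"
proof -
  define r s where "r = a mod 7" and "s = c mod 7"
  have "r < 7" "s < 7" by (simp_all add: r_def s_def)
  hence "kernel7 r (r + s) - kernel7 r s = 4 * legendre7 r * legendre7 (r + s)"
    by (elim residue7_cases) (simp_all add: kernel7_def legendre7_def numeral_2_eq_2[symmetric])
  moreover have "kernel7 r (r + s) = kernel7 a (a + c)" "kernel7 r s = kernel7 a c"
    by (rule kernel7_cong; simp add: r_def s_def mod_simps)+
  moreover have "legendre7 r = legendre7 a" "legendre7 (r + s) = legendre7 (a + c)"
    by (rule legendre7_cong; simp add: r_def s_def mod_simps)+
  ultimately show ?thesis by simp
qed

text \<open>The defect on the diagonal is the same for all residues, so it will only count the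
  quadruples with a = b.\<close>

lemma kernel7_diag: "4 * (legendre7 a)\<^sup>2 - kernel7 a a = 5"
proof -
  define r where "r = a mod 7"
  have "r < 7" by (simp add: r_def)
  hence "4 * (legendre7 r)\<^sup>2 - kernel7 r r = 5"
    by (elim residue7_cases) (simp_all add: kernel7_def legendre7_def numeral_2_eq_2[symmetric])
  moreover have "kernel7 r r = kernel7 a a" "legendre7 r = legendre7 a"
    by (rule kernel7_cong legendre7_cong; simp add: r_def)+
  ultimately show ?thesis by simp
qed

text \<open>\<open>6 * j\<close> stands for - j modulo 7: the sum runs over all pairs of residues
  with sum \<open>e\<close>.\<close>

lemma sum_kernel7_period:
  "(\<Sum>j<7. kernel7 (e + j) (6 * j)) = (if 7 dvd e then - 35 else - 7)"
proof -
  have "{..<7 :: nat} = {0, 1, 2, 3, 4, 5, 6}" by auto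
  define r where "r = e mod 7"
  have "r < 7" by (simp add: r_def)
  hence "(\<Sum>j<7. kernel7 (r + j) (6 * j)) = (if 7 dvd r then - 35 else - 7)"
    unfolding \<open>{..<7} = _\<close>
    by (elim residue7_cases) (simp_all add: kernel7_def legendre7_def numeral_2_eq_2[symmetric])
  moreover have "kernel7 (r + j) (6 * j) = kernel7 (e + j) (6 * j)" for j
    by (rule kernel7_cong; simp add: r_def mod_simps)
  moreover have "7 dvd r \<longleftrightarrow> 7 dvd e" by (simp add: r_def dvd_mod_iff)
  ultimately show ?thesis by simp
qed

text \<open>Raising \<open>d\<close> by 7 adds a full period of the kernel, -7 or -35, and 35 from
  the linear term: in total 28 or 0, as on the right. Hence seven initial values suffice.\<close>

lemma sum_kernel7:
  assumes "d > 0"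
  shows "(\<Sum>a=1..<d. kernel7 a (d - a)) + 5 * (int d - 1)
           = (if 7 dvd d then 0 else 4 * int d - 4 * legendre7 d)"
  using assms
proof (induction d rule: less_induct)
  case (less d)
  show ?case
  proof (cases "d \<le> 7")
    case True
    hence "d \<in> {1, 2, 3, 4, 5, 6, 7}" using less.prems by auto
    thus ?thesis
      by (elim insertE emptyE)
         (simp_all add: kernel7_def legendre7_def atLeastLessThan_nat_numeral numeral_2_eq_2[symmetric])
  next
    case False
    define e where "e = d - 7"
    have d: "d = e + 7" and "e > 0" using False by (auto simp: e_def)
    have cong: "kernel7 a (b - a) = kernel7 a (e + 6 * a)" if "a \<le> b" "b = e \<or> b = e + 7" for a b
    proof (rule kernel7_cong)
      have "(b - a) + 7 * a = e + 6 * a \<or> (b - a) + 7 * a = e + 6 * a + 7" using that by auto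
      hence "(b - a + 7 * a) mod 7 = (e + 6 * a) mod 7" 
        by (elim disjE) (simp_all only: mod_add_self2)
      thus "(b - a) mod 7 = (e + 6 * a) mod 7" by (simp only: mod_mult_self2)
    qed simp
    have "(\<Sum>a=1..<d. kernel7 a (d - a)) = (\<Sum>a=1..<e + 7. kernel7 a (e + 6 * a))"
      unfolding d by (rule sum.cong) (simp_all add: cong)
    also have "\<dots> = (\<Sum>a=1..<e. kernel7 a (e + 6 * a)) + (\<Sum>a=e..<e + 7. kernel7 a (e + 6 * a))"
      using \<open>e > 0\<close> by (simp add: sum.atLeastLessThan_concat)
    also have "(\<Sum>a=1..<e. kernel7 a (e + 6 * a)) = (\<Sum>a=1..<e. kernel7 a (e - a))"
      by (rule sum.cong) (simp_all add: cong)
    also have "(\<Sum>a=e..<e + 7. kernel7 a (e + 6 * a)) = (\<Sum>j<7. kernel7 (e + j) (e + 6 * (e + j)))"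
      by (rule sum.reindex_bij_witness[of _ "\<lambda>j. e + j" "\<lambda>a. a - e"]) auto
    also have "\<dots> = (\<Sum>j<7. kernel7 (e + j) (6 * j))"
    proof (intro sum.cong kernel7_cong refl)
      fix j
      have "e + 6 * (e + j) = 6 * j + 7 * e" by simp
      thus "(e + 6 * (e + j)) mod 7 = 6 * j mod 7" by (simp only: mod_mult_self2)
    qed
    finally have "(\<Sum>a=1..<d. kernel7 a (d - a))
      = (\<Sum>a=1..<e. kernel7 a (e - a)) + (if 7 dvd e then - 35 else - 7)"
      by (simp only: sum_kernel7_period)
    moreover have "7 dvd d \<longleftrightarrow> 7 dvd e" "legendre7 d = legendre7 e" by (simp_all add: d legendre7_def)
    ultimately show ?thesis using less.IH[of e] \<open>e > 0\<close> by (auto simp: d)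
  qed
qed

section \<open>Liouville's method for a x + b y = n\<close>

definition quads :: "nat \<Rightarrow> (nat \<times> nat \<times> nat \<times> nat) set" where
  "quads n = {(a, x, b, y). a > 0 \<and> x > 0 \<and> b > 0 \<and> y > 0 \<and> a * x + b * y = n}"

lemma finite_quads: "finite (quads n)"
proof (rule finite_subset)
  have le: "a \<le> n" "b \<le> n" if "0 < b" "a * b \<le> n" "0 < a" for a b
  proof -
    have "a \<le> a * b" "b \<le> a * b" using that by simp_all
    with that show "a \<le> n" "b \<le> n" by linarith+
  qed
  show "quads n \<subseteq> {..n} \<times> {..n} \<times> {..n} \<times> {..n}"
  proof
    fix p assume p: "p \<in> quads n"
    obtain a x b y where "p = (a, x, b, y)" by (cases p) auto
    with p show "p \<in> {..n} \<times> {..n} \<times> {..n} \<times> {..n}"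
      using le[of x a] le[of y b] by (auto simp: quads_def)
  qed
qed simp

text \<open>Swapping the two pairs identifies the part with < and the part with >. The applications
  are \<open>u = fst\<close>, comparing a with b, and \<open>u = snd\<close>, comparing x with
  y.\<close>

lemma sum_quads_split:
  fixes f :: "nat \<Rightarrow> nat \<Rightarrow> int" and u :: "nat \<times> nat \<Rightarrow> nat"
  assumes "\<And>a b. f a b = f b a"
  shows "(\<Sum>(a, x, b, y)\<in>quads n. f a b) =
           2 * (\<Sum>(a, x, b, y) | (a, x, b, y) \<in> quads n \<and> u (a, x) < u (b, y). f a b)
           + (\<Sum>(a, x, b, y) | (a, x, b, y) \<in> quads n \<and> u (a, x) = u (b, y). f a b)"
proof -
  let ?F = "\<lambda>(a, x, b, y). f a b"
  let ?L = "{(a, x, b, y). (a, x, b, y) \<in> quads n \<and> u (a, x) < u (b, y)}"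
  let ?G = "{(a, x, b, y). (a, x, b, y) \<in> quads n \<and> u (b, y) < u (a, x)}"
  let ?E = "{(a, x, b, y). (a, x, b, y) \<in> quads n \<and> u (a, x) = u (b, y)}"
  have fin: "finite ?L" "finite ?G" "finite ?E"
    by (rule finite_subset[OF _ finite_quads[of n]]; auto)+
  have "quads n = (?L \<union> ?G) \<union> ?E" by auto
  hence "sum ?F (quads n) = sum ?F ((?L \<union> ?G) \<union> ?E)" by simp
  also have "\<dots> = sum ?F ?L + sum ?F ?G + sum ?F ?E"
    using fin by (subst sum.union_disjoint; (subst sum.union_disjoint)?) auto
  also have "sum ?F ?G = sum ?F ?L"
    by (rule sum.reindex_bij_witness[of _ "\<lambda>(a, x, b, y). (b, y, a, x)" "\<lambda>(a, x, b, y). (b, y, a, x)"])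
       (auto simp: quads_def assms add.commute)
  finally show ?thesis by (simp only: mult_2)
qed

text \<open>The substitution \<open>(a, x, b, y) \<mapsto> (a, x - y, a + b, y)\<close> preserves \<open>a x + b y\<close>
  and matches the quadruples with \<open>x > y\<close> with those with \<open>a < b\<close>.\<close>

lemma sum_quads_euclid:
  fixes f :: "nat \<Rightarrow> nat \<Rightarrow> int"
  shows "(\<Sum>(a, x, b, y) | (a, x, b, y) \<in> quads n \<and> y < x. f a b)
       = (\<Sum>(a, x, b, y) | (a, x, b, y) \<in> quads n \<and> a < b. f a (b - a))"
proof (rule sum.reindex_bij_witness[of _ "\<lambda>(a, x, b, y). (a, x + y, b - a, y)" "\<lambda>(a, x, b, y). (a, x - y, a + b, y)"],
    goal_cases)
  case (2 p)
  then obtain a x b y where p: "p = (a, x, b, y)" "(a, x, b, y) \<in> quads n" "y < x" by auto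
  then obtain z where "x = y + z" "z > 0" using less_imp_add_positive by blast
  with p show ?case by (auto simp: quads_def algebra_simps)
next
  case (4 p)
  then obtain a x b y where p: "p = (a, x, b, y)" "(a, x, b, y) \<in> quads n" "a < b" by auto
  then obtain z where "b = a + z" "z > 0" using less_imp_add_positive by blast
  with p show ?case by (auto simp: quads_def algebra_simps)
qed auto

text \<open>For a < b the product of symbols is a kernel difference, and the Euclidean substitution
  turns its second term into a kernel sum over y < x. Evaluating the full kernel sum by both
  splittings cancels everything off the diagonals a = b and x = y.\<close>

lemma sum_quads_legendre7:
  assumes "n > 0"
  shows "(\<Sum>(a, x, b, y)\<in>quads n. legendre7 a * legendre7 b)
           = (\<Sum>d | d dvd n. if 7 dvd d then 0 else int d - legendre7 d)"
proof -
  let ?lt = "{(a, x, b, y). (a, x, b, y) \<in> quads n \<and> a < b}"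
  let ?eq = "{(a, x, b, y). (a, x, b, y) \<in> quads n \<and> a = b}"
  let ?gt' = "{(a, x, b, y). (a, x, b, y) \<in> quads n \<and> y < x}"
  let ?lt' = "{(a, x, b, y). (a, x, b, y) \<in> quads n \<and> x < y}"
  let ?eq' = "{(a, x, b, y). (a, x, b, y) \<in> quads n \<and> x = y}"
  let ?chi = "\<lambda>(a, x, b, y). legendre7 a * legendre7 b" and ?K = "\<lambda>(a, x, b, y). kernel7 a b"
  have "4 * sum ?chi ?lt = (\<Sum>(a, x, b, y)\<in>?lt. kernel7 a b - kernel7 a (b - a))"
    unfolding sum_distrib_left
  proof (intro sum.cong refl, clarify)
    fix a x b y :: nat assume "a < b"
    then obtain c where "b = a + c" using less_imp_add_positive by blast
    thus "4 * (legendre7 a * legendre7 b) = kernel7 a b - kernel7 a (b - a)"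
      using kernel7_diff[of a c] by simp
  qed
  also have "\<dots> = sum ?K ?lt - (\<Sum>(a, x, b, y)\<in>?lt. kernel7 a (b - a))"
    by (simp add: sum_subtractf case_prod_unfold)
  also have "(\<Sum>(a, x, b, y)\<in>?lt. kernel7 a (b - a)) = sum ?K ?gt'"
    by (rule sum_quads_euclid[symmetric])
  also have "sum ?K ?gt' = sum ?K ?lt'"
    by (rule sum.reindex_bij_witness[of _ "\<lambda>(a, x, b, y). (b, y, a, x)" "\<lambda>(a, x, b, y). (b, y, a, x)"])
       (auto simp: quads_def kernel7_commute add.commute)
  finally have lt: "4 * sum ?chi ?lt = sum ?K ?lt - sum ?K ?lt'" .
  have "sum ?chi (quads n) = 2 * sum ?chi ?lt + sum ?chi ?eq"
    using sum_quads_split[where u = fst and n = n and f = "\<lambda>a b. legendre7 a * legendre7 b"]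
    by (simp add: mult.commute)
  moreover have "sum ?K (quads n) = 2 * sum ?K ?lt + sum ?K ?eq"
    using sum_quads_split[where u = fst and n = n and f = kernel7] kernel7_commute by simp
  moreover have "sum ?K (quads n) = 2 * sum ?K ?lt' + sum ?K ?eq'"
    using sum_quads_split[where u = snd and n = n and f = kernel7] kernel7_commute by simp
  ultimately have "4 * sum ?chi (quads n) = sum ?K ?eq' + (4 * sum ?chi ?eq - sum ?K ?eq)"
    using lt by linarith
  also have "4 * sum ?chi ?eq - sum ?K ?eq = (\<Sum>(a, x, b, y)\<in>?eq. 5)"
    unfolding sum_distrib_left sum_subtractf[symmetric]
  proof (intro sum.cong refl, clarify)
    show "4 * (legendre7 b * legendre7 b) - kernel7 b b = 5" for b
      using kernel7_diag[of b] by (simp add: power2_eq_square)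
  qed
  \<comment> \<open>Both diagonals are fibred over the divisors d of n: d = x + y if a = b, and d =
    a + b if x = y.\<close>
  also have "\<dots> = (\<Sum>(d, x)\<in>(SIGMA d:{d. d dvd n}. {1..<d}). 5)"
  proof (rule sum.reindex_bij_witness[of _ "\<lambda>(d, x). (n div d, x, n div d, d - x)" "\<lambda>(a, x, b, y). (x + y, x)"],
      goal_cases)
    case (1 p)
    then obtain a x y where p: "p = (a, x, a, y)" "(a, x, a, y) \<in> quads n" by auto
    hence "n = a * (x + y)" "x + y > 0" by (auto simp: quads_def algebra_simps)
    with p show ?case by simp
  next
    case (2 p)
    then obtain a x y where p: "p = (a, x, a, y)" "(a, x, a, y) \<in> quads n" by auto
    hence "n = a * (x + y)" "x > 0" "y > 0" by (auto simp: quads_def algebra_simps)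
    with p show ?case by simp
  next
    case (4 q)
    then obtain d x where q: "q = (d, x)" "d dvd n" "1 \<le> x" "x < d" by auto
    then obtain z k where "d = x + z" "z > 0" "n = d * k" using less_imp_add_positive by (metis dvdE)
    moreover from this have "n div d = k" by simp
    ultimately show ?case using q(3) assms unfolding q(1)
      by (simp add: quads_def) (simp add: algebra_simps)
  qed auto
  also have "\<dots> = (\<Sum>d | d dvd n. \<Sum>x=1..<d. 5)"
    by (rule sum.Sigma[symmetric]) (use assms in auto)
  also have "sum ?K ?eq' = (\<Sum>(d, a)\<in>(SIGMA d:{d. d dvd n}. {1..<d}). kernel7 a (d - a))"
  proof (rule sum.reindex_bij_witness[of _ "\<lambda>(d, a). (a, n div d, d - a, n div d)" "\<lambda>(a, x, b, y). (a + b, a)"],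
      goal_cases)
    case (1 p)
    then obtain a x b where p: "p = (a, x, b, x)" "(a, x, b, x) \<in> quads n" by auto
    hence "n = (a + b) * x" "a + b > 0" by (auto simp: quads_def algebra_simps)
    with p show ?case by simp
  next
    case (2 p)
    then obtain a x b where p: "p = (a, x, b, x)" "(a, x, b, x) \<in> quads n" by auto
    hence "n = (a + b) * x" "a > 0" "b > 0" by (auto simp: quads_def algebra_simps)
    with p show ?case by simp
  next
    case (4 q)
    then obtain d x where q: "q = (d, x)" "d dvd n" "1 \<le> x" "x < d" by auto
    then obtain z k where "d = x + z" "z > 0" "n = d * k" using less_imp_add_positive by (metis dvdE)
    moreover from this have "n div d = k" by simp
    ultimately show ?case using q(3) assms unfolding q(1)
      by (simp add: quads_def) (simp add: algebra_simps)
  qed auto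
  also have "\<dots> = (\<Sum>d | d dvd n. \<Sum>a=1..<d. kernel7 a (d - a))"
    by (rule sum.Sigma[symmetric]) (use assms in auto)
  finally have "4 * sum ?chi (quads n) = (\<Sum>d | d dvd n. (\<Sum>a=1..<d. kernel7 a (d - a)) + (\<Sum>x=1..<d. 5))"
    by (simp add: sum.distrib)
  also have "\<dots> = (\<Sum>d | d dvd n. 4 * (if 7 dvd d then 0 else int d - legendre7 d))"
  proof (rule sum.cong)
    fix d assume "d \<in> {d. d dvd n}"
    hence "d > 0" using assms by (auto intro: Nat.gr0I)
    thus "(\<Sum>a=1..<d. kernel7 a (d - a)) + (\<Sum>x=1..<d. 5) = 4 * (if 7 dvd d then 0 else int d - legendre7 d)"
      using sum_kernel7[of d] by (simp add: of_nat_diff algebra_simps)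
  qed simp
  finally show ?thesis by (simp add: sum_distrib_left[symmetric])
qed

lemma divisor_sum_pairs: "divisor_sum g n = (\<Sum>(a, x) | a > 0 \<and> x > 0 \<and> a * x = n. g a)"
proof (cases "n = 0")
  case True
  hence "{(a, x). a > 0 \<and> x > 0 \<and> a * x = n} = {}" by auto
  thus ?thesis using True by (simp only: divisor_sum_def) simp
next
  case False
  have "(\<Sum>d | d dvd n. g d) = (\<Sum>(a, x) | a > 0 \<and> x > 0 \<and> a * x = n. g a)"
    by (rule sum.reindex_bij_witness[of _ fst "\<lambda>d. (d, n div d)"])
       (use False in \<open>auto elim!: dvdE\<close>)
  thus ?thesis using False by (simp add: divisor_sum_def)
qed

lemma finite_mult_eq: "finite {(a, x). a > 0 \<and> x > 0 \<and> a * x = (n :: nat)}"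
proof (rule finite_subset)
  show "{(a, x). a > 0 \<and> x > 0 \<and> a * x = n} \<subseteq> {..n} \<times> {..n}" by auto
qed simp

lemma sum_divisor_sum_mult:
  "(\<Sum>i=0..n. divisor_sum g i * divisor_sum h (n - i)) = (\<Sum>(a, x, b, y)\<in>quads n. g a * h b)"
proof -
  let ?D = "\<lambda>i. {(a, x). a > 0 \<and> x > 0 \<and> a * x = (i :: nat)}"
  have "(\<Sum>i=0..n. divisor_sum g i * divisor_sum h (n - i))
      = (\<Sum>i=0..n. \<Sum>p\<in>?D i. \<Sum>q\<in>?D (n - i). g (fst p) * h (fst q))"
    by (simp only: divisor_sum_pairs sum_product case_prod_unfold)
  also have "\<dots> = (\<Sum>i=0..n. \<Sum>z\<in>?D i \<times> ?D (n - i). g (fst (fst z)) * h (fst (snd z)))"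
    by (simp only: sum.cartesian_product case_prod_unfold)
  also have "\<dots> = (\<Sum>w\<in>(SIGMA i:{0..n}. ?D i \<times> ?D (n - i)). g (fst (fst (snd w))) * h (fst (snd (snd w))))"
    by (subst sum.Sigma) (auto simp: finite_mult_eq[unfolded case_prod_unfold] case_prod_unfold)
  also have "\<dots> = (\<Sum>(a, x, b, y)\<in>quads n. g a * h b)"
    by (rule sum.reindex_bij_witness[of _ "\<lambda>(a, x, b, y). (a * x, (a, x), (b, y))"
          "\<lambda>(i, (a, x), (b, y)). (a, x, b, y)"])
       (auto simp: quads_def)
  finally show ?thesis .
qed

definition legendre7_fps :: "complex fps" where
  "legendre7_fps = divisor_fps legendre7"

lemma divisor_sum_not_7_dvd:
  "divisor_sum (\<lambda>d. if 7 dvd d then 0 else int d) n =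
   divisor_sum int n - (if 7 dvd n then 7 * divisor_sum int (n div 7) else 0)"
proof (cases "n = 0")
  case False
  have fin: "finite {d. d dvd n}" using False by simp
  have "(\<Sum>d | d dvd n. int d) = (\<Sum>d | d dvd n. if 7 dvd d then 0 else int d)
          + (\<Sum>d | d dvd n. if 7 dvd d then int d else 0)"
    unfolding sum.distrib[symmetric] by (rule sum.cong) auto
  also have "(\<Sum>d | d dvd n. if 7 dvd d then int d else 0) = (\<Sum>d\<in>{d. d dvd n} \<inter> {d. 7 dvd d}. int d)"
    using fin by (simp add: sum.If_cases)
  also have "\<dots> = (if 7 dvd n then 7 * (\<Sum>d | d dvd n div 7. int d) else 0)"
  proof (cases "7 dvd n")
    case True
    then obtain k where k: "n = 7 * k" ..
    have "(\<Sum>d\<in>{d. d dvd n} \<inter> {d. 7 dvd d}. int d) = (\<Sum>d | d dvd k. 7 * int d)"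
      by (rule sum.reindex_bij_witness[of _ "\<lambda>d. 7 * d" "\<lambda>d. d div 7"]) (auto simp: k elim!: dvdE)
    thus ?thesis by (simp add: k sum_distrib_left)
  next
    case False
    hence "{d. d dvd n} \<inter> {d. 7 dvd d} = {}" by (auto intro: dvd_trans)
    thus ?thesis using False by (simp only:) simp
  qed
  finally show ?thesis using False by (auto simp: divisor_sum_def elim!: dvdE)
qed (simp add: divisor_sum_def)

text \<open>For L = 1 + 2 R with \<open>R = legendre7_fps\<close>, four times the left side is L^2 -
  1. The linear term cancels the symbols left over by the sum over quadruples; the sum of the
  divisors prime to 7 remains.\<close>

lemma legendre7_fps_square:
  "legendre7_fps ^ 2 + legendre7_fps = divisor_fps int - 7 * dil 7 (divisor_fps int)"
proof (rule fps_ext)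
  fix n
  have "(\<Sum>i=0..n. divisor_sum legendre7 i * divisor_sum legendre7 (n - i)) + divisor_sum legendre7 n
      = divisor_sum (\<lambda>d. if 7 dvd d then 0 else int d) n"
  proof (cases "n = 0")
    case False
    have "(if 7 dvd d then 0 else int d - legendre7 d) + legendre7 d = (if 7 dvd d then 0 else int d)" for d
      by (auto simp: legendre7_def elim!: dvdE)
    thus ?thesis using False
      by (simp only: sum_divisor_sum_mult sum_quads_legendre7 neq0_conv)
         (simp add: divisor_sum_def sum.distrib[symmetric])
  qed (simp add: divisor_sum_def)
  hence "of_int ((\<Sum>i=0..n. divisor_sum legendre7 i * divisor_sum legendre7 (n - i)) + divisor_sum legendre7 n)
      = (of_int (divisor_sum int n - (if 7 dvd n then 7 * divisor_sum int (n div 7) else 0)) :: complex)"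
    by (simp only: divisor_sum_not_7_dvd)
  thus "(legendre7_fps ^ 2 + legendre7_fps) $ n = (divisor_fps int - 7 * dil 7 (divisor_fps int)) $ n"
    by (simp add: legendre7_fps_def power2_eq_square fps_mult_nth[of "divisor_fps legendre7"]
        divisor_fps_nth dil_nth numeral_fps_const)
qed

section \<open>Hecke relations at 2\<close>

lemma divisor_sum_double:
  assumes "\<And>d. g (2 * d) = g 2 * g d"
  shows "divisor_sum g (2 * n) = (1 + g 2) * divisor_sum g n
           - (if even n then g 2 * divisor_sum g (n div 2) else 0)"
proof (cases "n = 0")
  case False
  let ?D = "\<lambda>n. {d :: nat. d dvd n}"
  have fin: "finite (?D n)" "finite (?D (2 * n))" using False by simp_all
  \<comment> \<open>A divisor of 2 n divides n or is twice a divisor of n. The overlap consists of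
    the doubled divisors of n / 2.\<close>
  have un: "?D (2 * n) = ?D n \<union> (\<lambda>d. 2 * d) ` ?D n"
  proof (intro equalityI subsetI)
    fix d assume d: "d \<in> ?D (2 * n)"
    show "d \<in> ?D n \<union> (\<lambda>d. 2 * d) ` ?D n"
    proof (cases "even d")
      case True
      thus ?thesis using d by (auto elim!: evenE)
    next
      case False
      hence "coprime d 2" by simp
      hence "d dvd n" using d by (simp add: coprime_dvd_mult_right_iff)
      thus ?thesis by simp
    qed
  qed auto
  have "sum g (?D (2 * n)) = sum g (?D n) + sum g ((\<lambda>d. 2 * d) ` ?D n) - sum g (?D n \<inter> (\<lambda>d. 2 * d) ` ?D n)"
    unfolding un using fin(1) by (subst sum_Un) auto
  also have "sum g ((\<lambda>d. 2 * d) ` ?D n) = g 2 * sum g (?D n)"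
    by (subst sum.reindex) (auto simp: inj_on_def o_def assms sum_distrib_left)
  also have "sum g (?D n \<inter> (\<lambda>d. 2 * d) ` ?D n) = (if even n then g 2 * sum g (?D (n div 2)) else 0)"
  proof (cases "even n")
    case True
    then obtain k where k: "n = 2 * k" by (elim evenE)
    have "?D n \<inter> (\<lambda>d. 2 * d) ` ?D n = (\<lambda>d. 2 * d) ` ?D k" unfolding k by auto
    thus ?thesis by (simp add: k sum.reindex inj_on_def o_def assms sum_distrib_left)
  next
    case False
    have "?D n \<inter> (\<lambda>d. 2 * d) ` ?D n = {}"
    proof (rule ccontr)
      assume "?D n \<inter> (\<lambda>d. 2 * d) ` ?D n \<noteq> {}"
      then obtain d where "2 * d dvd n" by blast
      hence "even n" by (rule dvd_mult_left)
      with False show False by simp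
    qed
    thus ?thesis using False by (simp only:) simp
  qed
  finally show ?thesis
    using False by (cases "even n") (auto simp: divisor_sum_def algebra_simps elim!: evenE)
qed (simp add: divisor_sum_def)

text \<open>The left side is twice the even part, so this is the eigenvalue equation of the Hecke
  operator at 2, with eigenvalue 1 + g(2).\<close>

lemma divisor_fps_alt:
  assumes "\<And>d. g (2 * d) = g 2 * g d"
  shows "divisor_fps g + alt (divisor_fps g)
           = 2 * ((1 + of_int (g 2)) * dil 2 (divisor_fps g) - of_int (g 2) * dil 4 (divisor_fps g))"
proof (rule fps_ext)
  fix n
  have c: "(1 + of_int (g 2) :: complex fps) = fps_const (of_int (1 + g 2))"
    "(of_int (g 2) :: complex fps) = fps_const (of_int (g 2))"
    by (simp_all add: fps_of_int[symmetric] fps_const_add[symmetric] del: fps_const_add)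
  show "(divisor_fps g + alt (divisor_fps g)) $ n
      = (2 * ((1 + of_int (g 2)) * dil 2 (divisor_fps g) - of_int (g 2) * dil 4 (divisor_fps g))) $ n"
  proof (cases "even n")
    case True
    then obtain m where m: "n = 2 * m" by (elim evenE)
    have 4: "4 dvd 2 * m \<longleftrightarrow> even m" "2 * m div 4 = m div 2" by presburger+
    show ?thesis
      unfolding c using divisor_sum_double[OF assms, of m]
      by (simp add: m alt_nth dil_nth divisor_fps_nth numeral_fps_const 4 distrib_right)
  next
    case False
    have "\<not> 4 dvd n" using False by (auto elim: evenE dvdE)
    show ?thesis
      unfolding c using False \<open>\<not> 4 dvd n\<close> by (simp add: alt_nth dil_nth numeral_fps_const distrib_right)
  qed
qed

section \<open>Recursion and differential equation\<close>

lemma fps_mult_nth_initial_zero: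
  fixes a b :: "'a :: comm_ring_1 fps"
  assumes "\<And>i. i < n \<Longrightarrow> a $ i = 0"
  shows "(a * b) $ n = a $ n * b $ 0"
proof -
  have "(a * b) $ n = (\<Sum>i\<in>{n}. a $ i * b $ (n - i))"
    unfolding fps_mult_nth by (rule sum.mono_neutral_right) (auto simp: assms)
  thus ?thesis by simp
qed

lemma dil_2_fixed_imp_const:
  assumes "dil 2 f = f"
  shows "f = fps_const (f $ 0)"
proof (rule fps_ext)
  fix n
  have "f $ n = 0" if "n > 0" using that
  proof (induction n rule: less_induct)
    case (less n)
    have "f $ n = (if even n then f $ (n div 2) else 0)"
      using dil_nth[of 2 f n] assms by simp
    thus ?case using less by (cases "even n") (auto elim!: evenE)
  qed
  thus "f $ n = fps_const (f $ 0) $ n" by simp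
qed

text \<open>The first two equations give \<open>f(q) + f(-q)\<close> and \<open>f(q) f(-q)\<close>, and hence \<open>f(q)\<close>, in terms
  of \<open>f(q\<^sup>2)\<close> and \<open>f(q\<^sup>4)\<close>. So the coefficients can be computed recursively.\<close>

lemma conic_unique:
  assumes f: "f + alt f = 4 * dil 2 f - 2 * dil 4 f"
    "f * alt f = 5 * dil 2 f ^ 2 - 8 * dil 2 f * dil 4 f + 4 * dil 4 f ^ 2"
  assumes g: "g + alt g = 4 * dil 2 g - 2 * dil 4 g"
    "g * alt g = 5 * dil 2 g ^ 2 - 8 * dil 2 g * dil 4 g + 4 * dil 4 g ^ 2"
  assumes init: "f $ 0 = 1" "f $ 1 = 2" "g $ 0 = 1" "g $ 1 = 2"
  shows "f = g"
proof -
  define h where "h = f - g"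
  define h2 h4 where "h2 = dil 2 h" and "h4 = dil 4 h"
  \<comment> \<open>In f f(-q) - g g(-q) the product \<open>h * c\<close> splits off, and the
    remainder g (h + h(-q)) is known from the linear equation.\<close>
  define c where "c = alt f - g"
  have "alt h = alt f - alt g" using alt_add[of h g] by (simp add: h_def)
  have h2: "h2 = dil 2 f - dil 2 g" and h4: "h4 = dil 4 f - dil 4 g"
    by (simp_all add: h2_def h4_def h_def dil_diff)
  have "h + alt h = (f + alt f) - (g + alt g)"
    unfolding \<open>alt h = _\<close> unfolding h_def by algebra
  hence lin: "h + alt h = 4 * h2 - 2 * h4"
    unfolding f(1) g(1) h2 h4 by algebra
  have "h * c + g * (h + alt h) = f * alt f - g * alt g"
    unfolding \<open>alt h = _\<close> unfolding h_def c_def by algebra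
  also have "\<dots> = h2 * (5 * (dil 2 f + dil 2 g) - 8 * dil 4 f) + h4 * (4 * (dil 4 f + dil 4 g) - 8 * dil 2 g)"
    unfolding f(2) g(2) h2 h4 by algebra
  finally have quad: "h * c = h2 * (5 * (dil 2 f + dil 2 g) - 8 * dil 4 f - 4 * g)
      + h4 * (4 * (dil 4 f + dil 4 g) - 8 * dil 2 g + 2 * g)"
    unfolding lin by algebra
  have "h $ n = 0" for n
  proof (induction n rule: less_induct)
    case (less n)
    consider "n = 0" | "n = 1" | "n \<ge> 2" by linarith
    thus ?case
    proof cases
      case 3
      \<comment> \<open>As n is at least 2, half of n + 1 is below n, so the induction hypothesis
        covers \<open>h2\<close> and \<open>h4\<close> up to the index n + 1.\<close>
      have z: "h2 $ i = 0" "h4 $ i = 0" if "i \<le> n + 1" for i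
        using that 3 less.IH by (auto simp: h2_def h4_def dil_nth)
      have "(h2 * k) $ (n + 1) = 0" "(h4 * k) $ (n + 1) = 0" for k
        unfolding fps_mult_nth by (intro sum.neutral ballI; simp add: z)+
      hence "(h * c) $ (n + 1) = 0" unfolding quad by simp
      moreover have "(h * c) $ (n + 1) = (\<Sum>i\<in>{n, n + 1}. h $ i * c $ (n + 1 - i))"
        unfolding fps_mult_nth by (rule sum.mono_neutral_right) (auto simp: less.IH)
      \<comment> \<open>\<open>c\<close> vanishes to order exactly one, so the coefficient n + 1 of
        \<open>h * c\<close> isolates the coefficient n of \<open>h\<close>. Prescribing the first
        coefficient separates f(q) from f(-q), which solve the same equations.\<close>
      moreover have "c $ 0 = 0" "c $ 1 = - 4" using init by (simp_all add: c_def alt_nth)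
      ultimately show ?thesis by simp
    qed (use init in \<open>simp_all add: h_def\<close>)
  qed
  hence "h = 0" by (simp add: fps_eq_iff)
  thus ?thesis by (simp add: h_def)
qed

text \<open>For f = q Y the equation is (q Y')^2 = M (Y + 1) (Y - 27). The difference of two such
  equations factors on both sides, and comparing coefficients gives 2 n h_n = 0. The constant term
  -1 of \<open>qderiv f - f\<close> fixes the sign of the square root.\<close>

lemma septic_ode_unique:
  assumes f: "(qderiv f - f) ^ 2 = M * ((f + fps_X) * (f - 27 * fps_X))"
  assumes g: "(qderiv g - g) ^ 2 = M * ((g + fps_X) * (g - 27 * fps_X))"
  assumes init: "f $ 0 = 1" "g $ 0 = 1" "M $ 0 = 1"
  shows "f = g"
proof -
  define h where "h = f - g"
  have qh: "qderiv h = qderiv f - qderiv g" by (simp add: h_def qderiv_diff)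
  have eq: "(qderiv h - h) * ((qderiv f - f) + (qderiv g - g)) = h * (M * (f + g - 26 * fps_X))"
  proof -
    have "(qderiv h - h) * ((qderiv f - f) + (qderiv g - g)) = (qderiv f - f) ^ 2 - (qderiv g - g) ^ 2"
      unfolding qh unfolding h_def by algebra
    also have "\<dots> = h * (M * (f + g - 26 * fps_X))"
      unfolding f g h_def by algebra
    finally show ?thesis .
  qed
  have "h $ n = 0" for n
  proof (induction n rule: less_induct)
    case (less n)
    have "(qderiv h - h) $ i = 0" if "i < n" for i
      using less.IH[OF that] by (simp add: qderiv_nth)
    hence "((qderiv h - h) * ((qderiv f - f) + (qderiv g - g))) $ n = (of_nat n - 1) * h $ n * (- 2)"
      by (subst fps_mult_nth_initial_zero) (simp_all add: qderiv_nth init algebra_simps)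
    moreover have "(h * (M * (f + g - 26 * fps_X))) $ n = h $ n * 2"
      by (subst fps_mult_nth_initial_zero) (simp_all add: less.IH init mult.assoc)
    ultimately have "(of_nat n - 1) * h $ n * (- 2) = h $ n * 2" using eq by metis
    hence "(2 * of_nat n) * h $ n = 0" by (simp add: algebra_simps)
    moreover have "h $ n = 0" if "n = 0" using that by (simp add: h_def init)
    ultimately show ?case by auto
  qed
  hence "h = 0" by (simp add: fps_eq_iff)
  thus ?thesis by (simp add: h_def)
qed

text \<open>The quotient of the two sides of the differential equation turns out to be invariant
  under \<open>q \<mapsto> q\<^sup>2\<close>, hence constant.\<close>

lemma septic_ode_of_doubling:
  fixes L U G :: "complex fps"
  assumes G: "G * U ^ 2 = (U + 4 * fps_X) ^ 3"
    and G2: "dil 2 G * U = (U + 2 * fps_X) ^ 3"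
    and L2: "dil 2 L * (U + 4 * fps_X) = L * (U + 2 * fps_X)"
    and init: "U $ 0 = 1" "G $ 0 = 1" "L $ 0 = 1"
  shows "(qderiv G - G) ^ 2 = L ^ 4 * ((G + fps_X) * (G - 27 * fps_X))"
proof -
  define X :: "complex fps" where "X = fps_X"
  define w where "w = qderiv U - U"
  define V where "V = dil 2 (qderiv G - G)"
  \<comment> \<open>With X set to 1, (Y + 1) (Y - 27) is K (u - 8)^2 / u^4, and the same expression
    for Y_2 is K (u - 1)^2 / u^2. The squared factors recur in \<open>d1\<close> and
    \<open>d2\<close> and cancel.\<close>
  define K where "K = (U + X) * (U ^ 2 + 5 * X * U + 8 * X ^ 2) * (U + 8 * X)"
  define N where "N = L ^ 4 * ((G + X) * (G - 27 * X))"
  define R where "R = (qderiv G - G) ^ 2 * inverse N"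
  have U0: "U \<noteq> 0" using init by auto
  have qX: "qderiv X = X" by (simp add: X_def)
  have G: "G * U ^ 2 = (U + 4 * X) ^ 3" and G2: "dil 2 G * U = (U + 2 * X) ^ 3"
    and L2: "dil 2 L * (U + 4 * X) = L * (U + 2 * X)"
    using assms by (simp_all add: X_def)
  have q3: "qderiv (f ^ 3) = 3 * f ^ 2 * qderiv f" and q2: "qderiv (f ^ 2) = 2 * f * qderiv f" for f
    using qderiv_power[of f 2] qderiv_power[of f 1] by (simp_all add: numeral_eq_Suc)
  have "qderiv G * U ^ 2 + G * (2 * U * qderiv U) = 3 * (U + 4 * X) ^ 2 * (qderiv U + 4 * X)"
    using arg_cong[OF G, of qderiv] by (simp add: qderiv_mult q3 q2 qderiv_add qX)
  note dG = this
  have "(qderiv G - G) * U ^ 3 = U * (qderiv G * U ^ 2 + G * (2 * U * qderiv U))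
          - 2 * (G * U ^ 2) * qderiv U - U * (G * U ^ 2)"
    by algebra
  also have "\<dots> = (U + 4 * X) ^ 2 * (U - 8 * X) * w"
    unfolding dG G w_def by algebra
  finally have d1: "(qderiv G - G) * U ^ 3 = (U + 4 * X) ^ 2 * (U - 8 * X) * w" .
  \<comment> \<open>The factor 2 from differentiating q^2 matches the 2 in the derivative 2 (u +
    2)^2 (u - 1) / u^2 of (u + 2)^3 / u.\<close>
  have V2: "2 * V = qderiv (dil 2 G) - 2 * dil 2 G"
    by (simp add: V_def qderiv_dil dil_diff algebra_simps)
  have dG2: "qderiv (dil 2 G) * U + dil 2 G * qderiv U = 3 * (U + 2 * X) ^ 2 * (qderiv U + 2 * X)"
    using arg_cong[OF G2, of qderiv] by (simp add: qderiv_mult q3 qderiv_add qX)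
  have "2 * V * U ^ 2 = U * (qderiv (dil 2 G) * U + dil 2 G * qderiv U)
          - (dil 2 G * U) * qderiv U - 2 * U * (dil 2 G * U)"
    unfolding V2 by algebra
  also have "\<dots> = 2 * ((U + 2 * X) ^ 2 * (U - X) * w)"
    unfolding dG2 G2 w_def by algebra
  finally have "2 * (V * U ^ 2) = 2 * ((U + 2 * X) ^ 2 * (U - X) * w)"
    by (simp only: mult.assoc)
  hence d2: "V * U ^ 2 = (U + 2 * X) ^ 2 * (U - X) * w" by simp
  have "N * U ^ 4 = L ^ 4 * (G * U ^ 2 + X * U ^ 2) * (G * U ^ 2 - 27 * X * U ^ 2)"
    unfolding N_def by algebra
  also have "\<dots> = L ^ 4 * K * (U - 8 * X) ^ 2"
    unfolding G K_def by algebra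
  finally have N: "N * U ^ 4 = L ^ 4 * K * (U - 8 * X) ^ 2" .
  have "dil 2 N = dil 2 L ^ 4 * ((dil 2 G + X ^ 2) * (dil 2 G - 27 * X ^ 2))"
    by (simp add: N_def X_def dil_mult dil_power dil_add dil_diff dil_X)
  hence "dil 2 N * U ^ 2 = dil 2 L ^ 4 * (dil 2 G * U + X ^ 2 * U) * (dil 2 G * U - 27 * X ^ 2 * U)"
    by algebra
  also have "\<dots> = dil 2 L ^ 4 * K * (U - X) ^ 2"
    unfolding G2 K_def by algebra
  finally have N2: "dil 2 N * U ^ 2 = dil 2 L ^ 4 * K * (U - X) ^ 2" .
  have N0: "N $ 0 = 1" using init by (simp add: N_def X_def fps_power_zeroth mult.assoc)
  hence "N \<noteq> 0" "dil 2 N \<noteq> 0" by (auto dest: arg_cong[of _ _ "\<lambda>f. f $ 0"])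
  have R: "R * N = (qderiv G - G) ^ 2"
    using N0 by (simp add: R_def mult.assoc inverse_mult_eq_1)
  have "dil 2 (R * N) = V ^ 2"
    unfolding R V_def by (simp add: dil_power)
  hence R2: "dil 2 R * dil 2 N = V ^ 2"
    by (simp only: dil_mult zero_less_numeral)
  have "U ^ 8 * ((qderiv G - G) ^ 2 * dil 2 N) = ((qderiv G - G) * U ^ 3) ^ 2 * (dil 2 N * U ^ 2)"
    by algebra
  also have "\<dots> = (dil 2 L * (U + 4 * X)) ^ 4 * ((U - 8 * X) ^ 2 * w ^ 2 * K * (U - X) ^ 2)"
    unfolding d1 N2 by algebra
  also have "\<dots> = ((U + 2 * X) ^ 2 * (U - X) * w) ^ 2 * (L ^ 4 * K * (U - 8 * X) ^ 2)"
    unfolding L2 by algebra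
  also have "\<dots> = U ^ 8 * (V ^ 2 * N)"
    unfolding d2[symmetric] N[symmetric] by algebra
  finally have "(qderiv G - G) ^ 2 * dil 2 N = V ^ 2 * N"
    using U0 by simp
  hence "dil 2 R * (dil 2 N * N) = R * (dil 2 N * N)"
    unfolding R[symmetric] R2[symmetric] by algebra
  hence "dil 2 R = R" using \<open>N \<noteq> 0\<close> \<open>dil 2 N \<noteq> 0\<close> by simp
  hence "R = fps_const (R $ 0)" by (rule dil_2_fixed_imp_const)
  moreover have "R $ 0 = 1"
    using arg_cong[OF R, of "\<lambda>f. f $ 0"] N0 init by (simp add: power2_eq_square)
  ultimately have "R = 1" by simp
  thus ?thesis using R by (simp add: N_def X_def)
qed

text \<open>The hypothesis says that t = \<tau> / q has the logarithmic derivative - L^2 (with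
  respect to q d/dq), so Y = t + 13 + 49/t satisfies q Y' = - L^2 (t - 49/t).\<close>

lemma septic_ode_of_riccati:
  fixes \<tau> L :: "complex fps"
  assumes "\<tau> $ 0 = 1" and \<tau>: "qderiv \<tau> = \<tau> * (1 - L ^ 2)"
  defines "G \<equiv> \<tau> + 13 * fps_X + 49 * fps_X ^ 2 * inverse \<tau>"
  shows "(qderiv G - G) ^ 2 = L ^ 4 * ((G + fps_X) * (G - 27 * fps_X))"
proof -
  define \<sigma> where "\<sigma> = inverse \<tau>"
  define X :: "complex fps" where "X = fps_X"
  have inv: "\<tau> * \<sigma> = 1" using assms(1) by (simp add: \<sigma>_def inverse_mult_eq_1')
  have "qderiv \<tau> * \<sigma> + \<tau> * qderiv \<sigma> = 0"
    using arg_cong[OF inv, of qderiv] by (simp add: qderiv_mult)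
  hence "\<sigma> * (qderiv \<tau> * \<sigma> + \<tau> * qderiv \<sigma>) = 0" by simp
  moreover have "\<sigma> * (qderiv \<tau> * \<sigma> + \<tau> * qderiv \<sigma>)
      = \<sigma> * ((\<tau> * \<sigma>) * (1 - L ^ 2)) + (\<tau> * \<sigma>) * qderiv \<sigma>"
    unfolding \<tau> by algebra
  ultimately have "\<sigma> * ((\<tau> * \<sigma>) * (1 - L ^ 2)) + (\<tau> * \<sigma>) * qderiv \<sigma> = 0" by simp
  hence \<sigma>: "qderiv \<sigma> = - \<sigma> * (1 - L ^ 2)"
    unfolding inv by (simp add: eq_neg_iff_add_eq_0 add.commute)
  have X: "qderiv X = X" by (simp add: X_def)
  have "qderiv (X ^ 2) = 2 * X ^ 2"
    by (simp add: power2_eq_square qderiv_mult X)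
  hence "qderiv G - G = - (L ^ 2) * (\<tau> - 49 * X ^ 2 * \<sigma>)"
    unfolding G_def X_def[symmetric] \<sigma>_def[symmetric]
    by (simp add: qderiv_add qderiv_mult \<sigma> \<tau> X) (simp add: algebra_simps)
  hence "(qderiv G - G) ^ 2 = L ^ 4 * (\<tau> - 49 * X ^ 2 * \<sigma>) ^ 2" by algebra
  \<comment> \<open>For the ring identity \<open>\<tau>\<close> and \<open>\<sigma>\<close> are
    independent, so the relation between them enters through a term that vanishes when their product
    is 1.\<close>
  also have "(\<tau> - 49 * X ^ 2 * \<sigma>) ^ 2 = (G + X) * (G - 27 * X) + 196 * X ^ 2 * (1 - \<tau> * \<sigma>)"
    unfolding G_def X_def[symmetric] \<sigma>_def[symmetric] by algebra
  finally show ?thesis by (simp add: X_def inv)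
qed

section \<open>The cube root\<close>

lemma alt_divisor_fps_int:
  "divisor_fps int + alt (divisor_fps int) = 6 * dil 2 (divisor_fps int) - 4 * dil 4 (divisor_fps int)"
  using divisor_fps_alt[of int] by (simp add: algebra_simps)

lemma alt_dil_7_divisor_fps_int:
  "dil 7 (divisor_fps int) + alt (dil 7 (divisor_fps int))
     = 6 * dil 2 (dil 7 (divisor_fps int)) - 4 * dil 4 (dil 7 (divisor_fps int))"
  using arg_cong[OF alt_divisor_fps_int, of "dil 7"]
  by (simp add: alt_dil_odd dil_add dil_diff dil_mult dil_dil)

lemma eta_septic_nth_0 [simp]: "eta_septic $ 0 = 1"
  by (simp add: eta_septic_def eta_fps_nth_0)

lemma eta_septic_nth_1: "eta_septic $ 1 = - 1"
proof -
  have "eta_fps $ 1 = - 1"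
    using eta_fps_nth[of 1 1] by (simp add: fps_mult_nth_1 numeral_2_eq_2)
  thus ?thesis by (simp add: eta_septic_def fps_mult_nth_1 dil_nth eta_fps_nth_0)
qed

lemma qderiv_eta_septic:
  "qderiv eta_septic = eta_septic * - (divisor_fps int + 7 * dil 7 (divisor_fps int))"
  by (simp add: eta_septic_def qderiv_mult qderiv_dil qderiv_eta_fps dil_mult
      dil_uminus algebra_simps)

text \<open>The logarithmic derivatives agree: T + T(-q) + 4 T(q^4) = 6 T(q^2) is the Hecke relation
  at 2 for the sum of divisors.\<close>

lemma eta_septic_cube:
  "eta_septic * alt eta_septic * dil 4 eta_septic = dil 2 eta_septic ^ 3"
proof -
  define A where "A = eta_septic"
  define S where "S = divisor_fps int"
  define T where "T = - (S + 7 * dil 7 S)"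
  have qA: "qderiv A = A * T" by (simp add: A_def T_def S_def qderiv_eta_septic)
  have altT: "alt T = - (alt S + 7 * alt (dil 7 S))"
    by (simp add: T_def alt_add alt_mult alt_uminus alt_diff)
  have dilT: "dil k T = - (dil k S + 7 * dil k (dil 7 S))" if "k > 0" for k
    using that by (simp add: T_def dil_add dil_mult dil_uminus dil_diff)
  have "T + alt T = - ((S + alt S) + 7 * (dil 7 S + alt (dil 7 S)))"
    unfolding altT unfolding T_def by algebra
  also have "\<dots> = 6 * dil 2 T - 4 * dil 4 T"
    unfolding S_def alt_divisor_fps_int alt_dil_7_divisor_fps_int
    by (simp add: dilT S_def algebra_simps)
  finally have T: "T + alt T + 4 * dil 4 T = 6 * dil 2 T" by simp
  have q4: "qderiv (dil 4 A) = dil 4 A * (4 * dil 4 T)" and q2: "qderiv (dil 2 A) = dil 2 A * (2 * dil 2 T)"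
    by (simp_all add: qderiv_dil qA dil_mult)
  have "qderiv (A * alt A * dil 4 A) = (A * alt A * dil 4 A) * (T + alt T + 4 * dil 4 T)"
    unfolding qderiv_mult qderiv_alt q4 unfolding qA alt_mult by algebra
  hence "qderiv (A * alt A * dil 4 A) = (A * alt A * dil 4 A) * (6 * dil 2 T)"
    by (simp only: T)
  moreover have "qderiv (dil 2 A ^ 3) = dil 2 A ^ 3 * (6 * dil 2 T)"
    unfolding power3_eq_cube qderiv_mult q2 by algebra
  ultimately have "A * alt A * dil 4 A = dil 2 A ^ 3"
    by (rule fps_eq_if_qderiv_eq) (simp_all add: A_def fps_power_zeroth)
  thus ?thesis by (simp add: A_def)
qed

text \<open>The right-hand side of the theorem is q A^3 times this series.\<close>

definition theta_eta :: "complex fps" where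
  "theta_eta = eta_septic ^ 2 * inverse (dil 2 eta_septic)
               + 4 * fps_X * dil 2 eta_septic ^ 2 * inverse eta_septic"

lemma theta_eta:
  "theta_eta * eta_septic * dil 2 eta_septic = eta_septic ^ 3 + 4 * fps_X * dil 2 eta_septic ^ 3"
proof -
  define A B where "A = eta_septic" and "B = dil 2 eta_septic"
  have "inverse A * A = 1" "inverse B * B = 1"
    by (simp_all add: A_def B_def inverse_mult_eq_1)
  moreover have "theta_eta * A * B = A ^ 3 * (inverse B * B) + 4 * fps_X * B ^ 3 * (inverse A * A)"
    unfolding theta_eta_def B_def[symmetric] unfolding A_def[symmetric] by algebra
  ultimately show ?thesis by (simp add: A_def B_def)
qed

lemma eta_septic_modular_equation:
  "dil 2 eta_septic ^ 3
     = eta_septic ^ 2 * dil 4 eta_septic + 2 * fps_X * eta_septic * dil 4 eta_septic ^ 2"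
  using eta_septic_cube unfolding alt_eta_septic by algebra

text \<open>After multiplication by B, the relation between A, B and E turns all four series into
  quadratic forms in A and q E. The equations of \<open>conic_unique\<close> then become polynomial
  identities.\<close>

lemma theta_eta_mult_dil_2:
  fixes A B E :: "complex fps"
  defines "A \<equiv> eta_septic" and "B \<equiv> dil 2 eta_septic" and "E \<equiv> dil 4 eta_septic"
  shows "theta_eta * B = A ^ 2 + 4 * fps_X * A * E + 8 * fps_X ^ 2 * E ^ 2"
    and "alt theta_eta * B = A ^ 2 + 4 * fps_X ^ 2 * E ^ 2"
    and "dil 2 theta_eta * B = A ^ 2 + 2 * fps_X * A * E + 4 * fps_X ^ 2 * E ^ 2"
    and "dil 4 theta_eta * B = A ^ 2 + 2 * fps_X * A * E + 2 * fps_X ^ 2 * E ^ 2"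
proof -
  define X :: "complex fps" where "X = fps_X"
  define H where "H = dil 8 eta_septic"
  have nz: "A \<noteq> 0" "B \<noteq> 0" "E \<noteq> 0"
    by (auto simp: A_def B_def E_def dest: arg_cong[of _ _ "\<lambda>f. f $ 0"])
  have mod: "B ^ 3 = A ^ 2 * E + 2 * X * A * E ^ 2"
    unfolding A_def B_def E_def X_def by (rule eta_septic_modular_equation)
  have th: "theta_eta * A * B = A ^ 3 + 4 * X * B ^ 3"
    unfolding A_def B_def X_def by (rule theta_eta)
  have dils: "dil 2 A = B" "dil 2 B = E" "dil 2 E = H" "dil 2 X = X ^ 2" "alt B = B" "alt E = E"
    "alt X = - X" "alt A = A + 2 * X * E"
    by (simp_all add: A_def B_def E_def H_def X_def dil_dil dil_X dil_alt alt_eta_septic)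
  have "A * (theta_eta * B) = A * (A ^ 2 + 4 * X * A * E + 8 * X ^ 2 * E ^ 2)"
    using th unfolding mod by algebra
  hence 1: "theta_eta * B = A ^ 2 + 4 * X * A * E + 8 * X ^ 2 * E ^ 2"
    using nz by simp
  have "alt theta_eta * B = (A + 2 * X * E) ^ 2 - 4 * X * (A + 2 * X * E) * E + 8 * X ^ 2 * E ^ 2"
    using arg_cong[OF 1, of alt] by (simp add: alt_mult alt_add alt_power dils)
  hence 2: "alt theta_eta * B = A ^ 2 + 4 * X ^ 2 * E ^ 2" by algebra
  have th2: "dil 2 theta_eta * B * E = B ^ 3 + 4 * X ^ 2 * E ^ 3"
    using arg_cong[OF th, of "dil 2"] by (simp add: dil_mult dil_add dil_power dils)
  hence "E * (dil 2 theta_eta * B) = E * (A ^ 2 + 2 * X * A * E + 4 * X ^ 2 * E ^ 2)"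
    unfolding mod by algebra
  hence 3: "dil 2 theta_eta * B = A ^ 2 + 2 * X * A * E + 4 * X ^ 2 * E ^ 2"
    using nz by simp
  have "dil 2 (dil 2 theta_eta * B) = dil 2 (A ^ 2 + 2 * X * A * E + 4 * X ^ 2 * E ^ 2)"
    by (simp only: 3)
  hence 4: "dil 4 theta_eta * E = B ^ 2 + 2 * X ^ 2 * B * H + 4 * (X ^ 2) ^ 2 * H ^ 2"
    by (simp add: dil_mult dil_add dil_power dil_dil dils)
  have "dil 2 (B ^ 3) = dil 2 (A ^ 2 * E + 2 * X * A * E ^ 2)"
    by (simp only: mod)
  hence mod2: "E ^ 3 = B ^ 2 * H + 2 * X ^ 2 * B * H ^ 2"
    by (simp add: dil_mult dil_add dil_power dils)
  \<comment> \<open>\<open>H\<close> occurs only in the combination that the relation at q^2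
    identifies with E^3, so it disappears.\<close>
  have "E * (dil 4 theta_eta * B) = (dil 4 theta_eta * E) * B" by algebra
  also have "\<dots> = B ^ 3 + 2 * X ^ 2 * E ^ 3"
    unfolding 4 mod2 by algebra
  also have "\<dots> = E * (A ^ 2 + 2 * X * A * E + 2 * X ^ 2 * E ^ 2)"
    unfolding mod by algebra
  finally have 4: "dil 4 theta_eta * B = A ^ 2 + 2 * X * A * E + 2 * X ^ 2 * E ^ 2"
    using nz by simp
  from 1 2 3 4
  show "theta_eta * B = A ^ 2 + 4 * fps_X * A * E + 8 * fps_X ^ 2 * E ^ 2"
    and "alt theta_eta * B = A ^ 2 + 4 * fps_X ^ 2 * E ^ 2"
    and "dil 2 theta_eta * B = A ^ 2 + 2 * fps_X * A * E + 4 * fps_X ^ 2 * E ^ 2"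
    and "dil 4 theta_eta * B = A ^ 2 + 2 * fps_X * A * E + 2 * fps_X ^ 2 * E ^ 2"
    by (simp_all only: X_def)
qed

lemma theta_eta_conic:
  "theta_eta + alt theta_eta = 4 * dil 2 theta_eta - 2 * dil 4 theta_eta"
  "theta_eta * alt theta_eta
     = 5 * dil 2 theta_eta ^ 2 - 8 * dil 2 theta_eta * dil 4 theta_eta + 4 * dil 4 theta_eta ^ 2"
proof -
  define B where "B = dil 2 eta_septic"
  define t ta t2 t4 where t_defs: "t = theta_eta" "ta = alt theta_eta" "t2 = dil 2 theta_eta" "t4 = dil 4 theta_eta"
  have "B $ 0 = 1" by (simp add: B_def)
  hence "B \<noteq> 0" by auto
  note eqs = theta_eta_mult_dil_2[folded B_def t_defs]
  have "B * (t + ta) = t * B + ta * B" by algebra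
  also have "\<dots> = 4 * (t2 * B) - 2 * (t4 * B)" unfolding eqs by algebra
  also have "\<dots> = B * (4 * t2 - 2 * t4)" by algebra
  finally show "t + ta = 4 * t2 - 2 * t4" using \<open>B \<noteq> 0\<close> by simp
  have "B ^ 2 * (t * ta) = (t * B) * (ta * B)" by algebra
  also have "\<dots> = 5 * (t2 * B) ^ 2 - 8 * (t2 * B) * (t4 * B) + 4 * (t4 * B) ^ 2"
    unfolding eqs by algebra
  also have "\<dots> = B ^ 2 * (5 * t2 ^ 2 - 8 * t2 * t4 + 4 * t4 ^ 2)" by algebra
  finally show "t * ta = 5 * t2 ^ 2 - 8 * t2 * t4 + 4 * t4 ^ 2" using \<open>B \<noteq> 0\<close> by simp
qed

definition theta7 :: "complex fps" where
  "theta7 = 1 + 2 * legendre7_fps"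

lemma legendre7_double: "legendre7 (2 * d) = legendre7 d"
proof -
  have "2 * d mod 7 = 2 * (d mod 7) mod 7" by (simp add: mod_simps)
  moreover have "d mod 7 < 7" by simp
  ultimately show ?thesis
    by (elim residue7_cases[of "d mod 7"]) (simp_all add: legendre7_def)
qed

lemma theta7_square:
  "theta7 ^ 2 = 1 + 4 * (divisor_fps int - 7 * dil 7 (divisor_fps int))"
  unfolding legendre7_fps_square[symmetric] theta7_def by algebra

text \<open>The product comes from 2 L L(-q) = (L + L(-q))^2 - (L^2 + L(-q)^2). The constant terms
  fit the Hecke relations of L and L^2, as 4 - 2 = 6 - 4 = 2.\<close>

lemma theta7_conic:
  "theta7 + alt theta7 = 4 * dil 2 theta7 - 2 * dil 4 theta7"
  "theta7 * alt theta7 = 5 * dil 2 theta7 ^ 2 - 8 * dil 2 theta7 * dil 4 theta7 + 4 * dil 4 theta7 ^ 2"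
proof -
  define R where "R = legendre7_fps"
  define S where "S = divisor_fps int"
  define W where "W = S - 7 * dil 7 S"
  have two: "legendre7 2 = 1" by (simp add: legendre7_def)
  hence "legendre7 (2 * d) = legendre7 2 * legendre7 d" for d by (simp add: legendre7_double)
  from divisor_fps_alt[OF this] have R: "R + alt R = 4 * dil 2 R - 2 * dil 4 R"
    by (simp add: two R_def legendre7_fps_def algebra_simps)
  have th: "theta7 = 1 + 2 * R" by (simp add: theta7_def R_def)
  have dil: "dil k theta7 = 1 + 2 * dil k R" if "k > 0" for k
    using that by (simp add: th dil_add dil_mult)
  have alt: "alt theta7 = 1 + 2 * alt R"
    by (simp add: th alt_add alt_mult)
  have "theta7 + alt theta7 = 2 + 2 * (R + alt R)" unfolding alt unfolding th by algebra
  also have "\<dots> = 4 * dil 2 theta7 - 2 * dil 4 theta7"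
    unfolding R by (simp add: dil)
  finally show 1: "theta7 + alt theta7 = 4 * dil 2 theta7 - 2 * dil 4 theta7" .
  have altW: "alt W = alt S - 7 * alt (dil 7 S)"
    by (simp add: W_def alt_diff alt_mult)
  have dilW: "dil k W = dil k S - 7 * dil k (dil 7 S)" if "k > 0" for k
    using that by (simp add: W_def dil_diff dil_mult)
  have "W + alt W = (S + alt S) - 7 * (dil 7 S + alt (dil 7 S))"
    unfolding altW unfolding W_def by algebra
  also have "\<dots> = 6 * dil 2 W - 4 * dil 4 W"
    unfolding S_def alt_divisor_fps_int alt_dil_7_divisor_fps_int
    by (simp add: dilW S_def algebra_simps)
  finally have W: "W + alt W = 6 * dil 2 W - 4 * dil 4 W" .
  have sq: "theta7 ^ 2 = 1 + 4 * W" unfolding theta7_square W_def S_def ..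
  have sqa: "alt theta7 ^ 2 = 1 + 4 * alt W"
    using arg_cong[OF sq, of alt] by (simp add: alt_power alt_add alt_mult)
  have sqd: "dil k theta7 ^ 2 = 1 + 4 * dil k W" if "k > 0" for k
    using arg_cong[OF sq, of "dil k"] that by (simp add: dil_power dil_add dil_mult)
  have "2 * (theta7 * alt theta7) = (theta7 + alt theta7) ^ 2 - (theta7 ^ 2 + alt theta7 ^ 2)"
    by algebra
  also have "theta7 ^ 2 + alt theta7 ^ 2 = 2 + 4 * (W + alt W)"
    unfolding sq sqa by algebra
  also have "\<dots> = 6 * dil 2 theta7 ^ 2 - 4 * dil 4 theta7 ^ 2"
    unfolding W by (simp add: sqd)
  finally have "2 * (theta7 * alt theta7)
      = 2 * (5 * dil 2 theta7 ^ 2 - 8 * dil 2 theta7 * dil 4 theta7 + 4 * dil 4 theta7 ^ 2)"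
    unfolding 1 by algebra
  thus "theta7 * alt theta7 = 5 * dil 2 theta7 ^ 2 - 8 * dil 2 theta7 * dil 4 theta7 + 4 * dil 4 theta7 ^ 2"
    by (metis mult_left_cancel zero_neq_numeral)
qed

lemma theta_eta_eq_theta7: "theta_eta = theta7"
proof (rule conic_unique)
  have "theta_eta * dil 2 eta_septic = eta_septic ^ 2 + fps_X * (4 * eta_septic * dil 4 eta_septic
          + 8 * fps_X * dil 4 eta_septic ^ 2)"
    unfolding theta_eta_mult_dil_2(1) by algebra
  note eq = this
  have B1: "dil 2 eta_septic $ 1 = 0" by (simp add: dil_nth)
  show t0: "theta_eta $ 0 = 1"
    using arg_cong[OF eq, of "\<lambda>f. f $ 0"] by (simp add: fps_power_zeroth)
  have "(eta_septic ^ 2) $ 1 = - 2"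
    using eta_septic_nth_1 by (simp add: power2_eq_square fps_mult_nth_1)
  moreover have "(fps_X * (4 * eta_septic * dil 4 eta_septic + 8 * fps_X * dil 4 eta_septic ^ 2)) $ 1 = 4"
    by (simp add: mult.assoc)
  ultimately show "theta_eta $ 1 = 2"
    using arg_cong[OF eq, of "\<lambda>f. f $ 1"] B1 t0 by (simp add: fps_mult_nth_1)
  show "theta7 $ 0 = 1"
    by (simp add: theta7_def legendre7_fps_def divisor_fps_nth divisor_sum_def)
  have "legendre7_fps $ 1 = 1"
    by (simp add: legendre7_fps_def divisor_fps_nth divisor_sum_def legendre7_def)
  thus "theta7 $ 1 = 2"
    by (simp add: theta7_def numeral_fps_const)
qed (fact theta_eta_conic theta7_conic)+

lemma theta7_cube:
  fixes F F7 \<tau> :: "complex fps"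
  defines "F \<equiv> eta_fps" and "F7 \<equiv> dil 7 eta_fps"
  defines "\<tau> \<equiv> F ^ 4 * inverse (F7 ^ 4)"
  shows "theta7 ^ 3 = eta_septic ^ 3 * (\<tau> + 13 * fps_X + 49 * fps_X ^ 2 * inverse \<tau>)"
proof -
  define X :: "complex fps" where "X = fps_X"
  define A B E where "A = eta_septic" and "B = dil 2 eta_septic" and "E = dil 4 eta_septic"
  \<comment> \<open>\<open>t\<close> denotes L here; the level 7 function t is \<open>\<tau>\<close>
    divided by q. Below, \<open>U\<close> is q u and \<open>G\<close> is q Y.\<close>
  define t t2 where "t = theta7" and "t2 = dil 2 theta7"
  define U where "U = A ^ 3 * inverse (B ^ 3)"
  define G where "G = t ^ 3 * inverse (A ^ 3)"
  have zeroth: "A $ 0 = 1" "B $ 0 = 1" "E $ 0 = 1" "F $ 0 = 1" "F7 $ 0 = 1"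
    by (simp_all add: A_def B_def E_def F_def F7_def eta_fps_nth_0)
  have nz: "A \<noteq> 0" "B \<noteq> 0" using zeroth by auto
  have U: "A ^ 3 = U * B ^ 3"
    unfolding U_def mult.assoc by (subst inverse_mult_eq_1) (simp_all add: zeroth fps_power_zeroth)
  have G: "G * A ^ 3 = t ^ 3"
    unfolding G_def mult.assoc by (subst inverse_mult_eq_1) (simp_all add: zeroth fps_power_zeroth)
  have t0: "t $ 0 = 1"
    by (simp add: t_def theta7_def legendre7_fps_def divisor_fps_nth divisor_sum_def)
  have mod: "B ^ 3 = A ^ 2 * E + 2 * X * A * E ^ 2"
    unfolding A_def B_def E_def X_def by (rule eta_septic_modular_equation)
  have th: "t * A * B = A ^ 3 + 4 * X * B ^ 3"
    using theta_eta unfolding A_def B_def X_def t_def theta_eta_eq_theta7 .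
  have th2: "t2 * B = A ^ 2 + 2 * X * A * E + 4 * X ^ 2 * E ^ 2"
    using theta_eta_mult_dil_2(3) unfolding A_def B_def E_def X_def t2_def theta_eta_eq_theta7 .
  have "B * (t * A) = B * (B ^ 2 * (U + 4 * X))"
    using th unfolding U by algebra
  hence tA: "t * A = B ^ 2 * (U + 4 * X)" using nz by simp
  have "B * (t2 * A) = A * (t2 * B)" by algebra
  also have "\<dots> = A ^ 3 + 2 * X * (A ^ 2 * E + 2 * X * A * E ^ 2)"
    unfolding th2 by algebra
  also have "\<dots> = B * (B ^ 2 * (U + 2 * X))"
    unfolding mod[symmetric] U by algebra
  finally have t2A: "t2 * A = B ^ 2 * (U + 2 * X)" using nz by simp
  have "A * (t2 * (U + 4 * X)) = (t2 * A) * (U + 4 * X)" by algebra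
  also have "\<dots> = (t * A) * (U + 2 * X)" unfolding tA t2A by algebra
  also have "\<dots> = A * (t * (U + 2 * X))" by algebra
  finally have L2: "t2 * (U + 4 * X) = t * (U + 2 * X)" using nz by simp
  have "B ^ 6 * (G * U ^ 2) = (G * (U * B ^ 3)) * (U * B ^ 3)" by algebra
  also have "\<dots> = (t * A) ^ 3" unfolding U[symmetric] G by algebra
  also have "\<dots> = B ^ 6 * (U + 4 * X) ^ 3" unfolding tA by algebra
  finally have GU: "G * U ^ 2 = (U + 4 * X) ^ 3" using nz by simp
  have dils: "dil 2 A = B" "dil 2 t = t2"
    by (simp_all add: A_def B_def t_def t2_def)
  have G2: "dil 2 G * B ^ 3 = t2 ^ 3"
    using arg_cong[OF G, of "dil 2"] by (simp add: dil_mult dil_power dils)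
  have "B ^ 6 * (dil 2 G * U) = (dil 2 G * B ^ 3) * (U * B ^ 3)" by algebra
  also have "\<dots> = (t2 * A) ^ 3" unfolding U[symmetric] G2 by algebra
  also have "\<dots> = B ^ 6 * (U + 2 * X) ^ 3" unfolding t2A by algebra
  finally have G2U: "dil 2 G * U = (U + 2 * X) ^ 3" using nz by simp
  have U0: "U $ 0 = 1" and G0: "G $ 0 = 1"
    by (simp_all add: U_def G_def zeroth t0 fps_power_zeroth)
  have ode1: "(qderiv G - G) ^ 2 = t ^ 4 * ((G + fps_X) * (G - 27 * fps_X))"
    by (rule septic_ode_of_doubling[where U = U])
       (use GU G2U L2 U0 G0 t0 in \<open>simp_all add: X_def t2_def t_def\<close>)
  define S where "S = divisor_fps int"
  have qF: "qderiv F = - F * S" unfolding F_def S_def by (rule qderiv_eta_fps)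
  have qF7: "qderiv F7 = - 7 * F7 * dil 7 S"
    by (simp add: F7_def qderiv_dil qderiv_eta_fps S_def dil_mult dil_uminus)
  have \<tau>0: "\<tau> $ 0 = 1" by (simp add: \<tau>_def zeroth fps_power_zeroth)
  have \<tau>F: "\<tau> * F7 ^ 4 = F ^ 4"
    unfolding \<tau>_def mult.assoc by (subst inverse_mult_eq_1) (simp_all add: zeroth fps_power_zeroth)
  have q4: "qderiv (f ^ 4) = 4 * f ^ 3 * qderiv f" for f
    using qderiv_power[of f 3] by (simp add: numeral_eq_Suc)
  have "F7 ^ 4 * qderiv \<tau> = qderiv (\<tau> * F7 ^ 4) - \<tau> * qderiv (F7 ^ 4)"
    by (simp add: qderiv_mult)
  also have "\<dots> = 4 * F ^ 3 * (- F * S) - \<tau> * (4 * F7 ^ 3 * (- 7 * F7 * dil 7 S))"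
    unfolding \<tau>F q4 qF qF7 ..
  also have "\<dots> = (\<tau> * F7 ^ 4) * (28 * dil 7 S) - F ^ 4 * (4 * S)"
    by algebra
  also have "\<dots> = F7 ^ 4 * (\<tau> * (1 - (1 + 4 * (S - 7 * dil 7 S))))"
    unfolding \<tau>F[symmetric] by algebra
  also have "1 + 4 * (S - 7 * dil 7 S) = t ^ 2"
    unfolding t_def theta7_square S_def ..
  finally have "F7 ^ 4 * qderiv \<tau> = F7 ^ 4 * (\<tau> * (1 - t ^ 2))" .
  moreover have "F7 \<noteq> 0" using zeroth by auto
  ultimately have "qderiv \<tau> = \<tau> * (1 - t ^ 2)" by (metis mult_left_cancel power_not_zero)
  note ode2 = septic_ode_of_riccati[OF \<tau>0 this]
  have "G = \<tau> + 13 * fps_X + 49 * fps_X ^ 2 * inverse \<tau>"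
    by (rule septic_ode_unique[OF ode1 ode2]) (simp_all add: G0 \<tau>0 t0 fps_power_zeroth mult.assoc)
  thus ?thesis using G unfolding t_def A_def by (simp add: mult.commute)
qed

lemma fps_cube_root_eqI:
  assumes "g ^ 3 = G" "g $ 0 = 1"
  shows "fps_cube_root G = g"
proof -
  have "G $ 0 = 1" using assms by (auto simp: fps_power_zeroth)
  from fps_cube_root_ex1[OF this] show ?thesis
    unfolding fps_cube_root_def using assms by (blast intro: the1_equality)
qed

text \<open>This also settles convergence: the formal cube root is now a product of series that
  converge in the unit disc.\<close>

lemma fps_cube_root_Delta47_eq: "fps_cube_root Delta47_cube_fps = eta_septic ^ 3 * theta7"
proof (rule fps_cube_root_eqI)
  define F F7 where "F = eta_fps" and "F7 = dil 7 eta_fps"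
  define \<tau> where "\<tau> = F ^ 4 * inverse (F7 ^ 4)"
  define \<sigma> where "\<sigma> = inverse \<tau>"
  have zeroth: "F $ 0 = 1" "F7 $ 0 = 1" by (simp_all add: F_def F7_def eta_fps_nth_0)
  have \<tau>F: "\<tau> * F7 ^ 4 = F ^ 4"
    unfolding \<tau>_def mult.assoc by (subst inverse_mult_eq_1) (simp_all add: zeroth fps_power_zeroth)
  have "\<sigma> * \<tau> = 1"
    unfolding \<sigma>_def by (rule inverse_mult_eq_1) (simp add: \<tau>_def zeroth fps_power_zeroth)
  hence \<sigma>F: "\<sigma> * F ^ 4 = F7 ^ 4"
    unfolding \<tau>F[symmetric] by (simp add: mult.assoc[symmetric])
  have es: "eta_septic = F * F7" by (simp add: eta_septic_def F_def F7_def)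
  have "theta7 ^ 3 = eta_septic ^ 3 * (\<tau> + 13 * fps_X + 49 * fps_X ^ 2 * \<sigma>)"
    unfolding \<sigma>_def \<tau>_def F_def F7_def by (rule theta7_cube)
  hence "(eta_septic ^ 3 * theta7) ^ 3 = F ^ 12 * F7 ^ 12 * (\<tau> + 13 * fps_X + 49 * fps_X ^ 2 * \<sigma>)"
    unfolding es by algebra
  also have "\<dots> = F ^ 12 * F7 ^ 8 * (\<tau> * F7 ^ 4) + 13 * fps_X * F ^ 12 * F7 ^ 12
      + 49 * fps_X ^ 2 * F ^ 8 * F7 ^ 12 * (\<sigma> * F ^ 4)"
    by algebra
  also have "\<dots> = Delta47_cube_fps"
    unfolding \<tau>F \<sigma>F Delta47_cube_fps_def Let_def F7_def[unfolded dil_def, symmetric]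
    unfolding F_def[symmetric] by algebra
  finally show "(eta_septic ^ 3 * theta7) ^ 3 = Delta47_cube_fps" .
  show "(eta_septic ^ 3 * theta7) $ 0 = 1"
    by (simp add: theta7_def legendre7_fps_def divisor_fps_nth divisor_sum_def fps_power_zeroth)
qed

text \<open>Multiplied by B, so that evaluation at a complex number involves sums, products and
  powers, but no inverse series.\<close>

lemma fps_cube_root_Delta47_mult:
  "fps_cube_root Delta47_cube_fps * dil 2 eta_septic
     = eta_septic ^ 5 + 4 * fps_X * eta_septic ^ 2 * dil 2 eta_septic ^ 3"
proof -
  have "fps_cube_root Delta47_cube_fps * dil 2 eta_septic
      = eta_septic ^ 2 * (theta_eta * eta_septic * dil 2 eta_septic)"
    unfolding fps_cube_root_Delta47_eq theta_eta_eq_theta7 by algebra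
  also have "\<dots> = eta_septic ^ 5 + 4 * fps_X * eta_septic ^ 2 * dil 2 eta_septic ^ 3"
    unfolding theta_eta by algebra
  finally show ?thesis .
qed

section \<open>Evaluation\<close>

lemma less_fps_conv_radius:
  assumes "fps_conv_radius f \<ge> 1" "norm x < 1"
  shows "ereal (norm x) < fps_conv_radius f"
proof (rule less_le_trans[OF _ assms(1)])
  show "ereal (norm x) < 1" using assms(2) by simp
qed

lemma fps_conv_radius_mult_ge_1:
  fixes f g :: "complex fps"
  assumes "fps_conv_radius f \<ge> 1" "fps_conv_radius g \<ge> 1"
  shows "fps_conv_radius (f * g) \<ge> 1"
  by (rule order.trans[OF _ fps_conv_radius_mult]) (use assms in simp)

lemma summable_linear_times_power:
  assumes "norm (z :: complex) < 1"
  shows "summable (\<lambda>n. real (n + 1) * norm z ^ n)"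
proof -
  have "fps_conv_radius (Abs_fps (\<lambda>_. 1 :: real)) \<ge> 1"
    unfolding fps_conv_radius_def
    by (rule conv_radius_geI_ex') (auto intro!: summable_geometric)
  hence "fps_conv_radius (fps_deriv (Abs_fps (\<lambda>_. 1 :: real))) \<ge> 1"
    by (rule order.trans[OF _ fps_conv_radius_deriv])
  hence "summable (\<lambda>n. fps_deriv (Abs_fps (\<lambda>_. 1 :: real)) $ n * norm z ^ n)"
    using assms by (intro summable_fps less_fps_conv_radius) simp_all
  thus ?thesis by (simp add: add.commute)
qed

lemma fps_conv_radius_ge_1_if_linear_bound:
  fixes f :: "complex fps"
  assumes "\<And>n. norm (f $ n) \<le> C * real (n + 1)"
  shows "fps_conv_radius f \<ge> 1"
  unfolding fps_conv_radius_def
proof (rule conv_radius_geI_ex')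
  fix r :: real assume r: "r > 0" "ereal r < 1"
  have "summable (\<lambda>n. C * (real (n + 1) * norm (of_real r :: complex) ^ n))"
    using r by (intro summable_mult summable_linear_times_power) simp
  thus "summable (\<lambda>n. f $ n * of_real r ^ n)"
    by (rule summable_comparison_test[rotated])
       (use r mult_right_mono[OF assms] in \<open>auto simp: norm_mult norm_power mult.assoc intro!: exI[of _ 0]\<close>)
qed

lemma fps_conv_radius_eta: "fps_conv_radius eta_fps \<ge> 1"
proof (rule fps_conv_radius_ge_1_if_linear_bound)
  fix n
  have "{m. pentagonal m = n} \<subseteq> {- int n..int n}"
  proof
    fix m assume "m \<in> {m. pentagonal m = n}"
    thus "m \<in> {- int n..int n}" using abs_le_pentagonal[of m] by auto
  qed
  hence card: "card {m. pentagonal m = n} \<le> card {- int n..int n}"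
    by (intro card_mono) auto
  have "norm (eta_fps $ n) \<le> (\<Sum>m | pentagonal m = n. norm (sgn_parity m :: complex))"
    unfolding eta_fps_nth_pentagonal by (rule norm_sum)
  also have "\<dots> = real (card {m. pentagonal m = n})"
    by (simp add: sgn_parity_def if_distrib[of norm] cong: if_cong)
  also have "\<dots> \<le> 2 * real (n + 1)" using card by simp
  finally show "norm (eta_fps $ n) \<le> 2 * real (n + 1)" .
qed

lemma fps_conv_radius_theta7: "fps_conv_radius theta7 \<ge> 1"
proof -
  have "fps_conv_radius legendre7_fps \<ge> 1"
  proof (rule fps_conv_radius_ge_1_if_linear_bound)
    fix n
    have "\<bar>divisor_sum legendre7 n\<bar> \<le> int n"
    proof (cases "n = 0")
      case False
      have "\<bar>\<Sum>d | d dvd n. legendre7 d\<bar> \<le> (\<Sum>d | d dvd n. 1)"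
        by (rule order.trans[OF sum_abs sum_mono]) (simp add: legendre7_def)
      also have "\<dots> = int (card {d. d dvd n})" by simp
      also have "\<dots> \<le> int (card {0<..n})"
        unfolding of_nat_le_iff using False
        by (intro card_mono) (auto dest: dvd_imp_le intro: Nat.gr0I)
      finally show ?thesis using False by (simp add: divisor_sum_def)
    qed (simp add: divisor_sum_def)
    hence "norm (legendre7_fps $ n) \<le> real n"
      by (simp add: legendre7_fps_def divisor_fps_nth)
    thus "norm (legendre7_fps $ n) \<le> 1 * real (n + 1)" by simp
  qed
  hence "fps_conv_radius (2 * legendre7_fps) \<ge> 1"
    by (intro fps_conv_radius_mult_ge_1) simp_all
  thus ?thesis
    unfolding theta7_def by (intro order.trans[OF _ fps_conv_radius_add]) simp
qed

lemma eval_fps_dil: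
  assumes "fps_conv_radius f \<ge> 1" "k > 0"
  shows "fps_conv_radius (dil k f) \<ge> 1"
    and "norm q < 1 \<Longrightarrow> eval_fps (dil k f) q = eval_fps f (q ^ k)"
proof -
  have sums: "(\<lambda>n. dil k f $ n * q ^ n) sums eval_fps f (q ^ k)" if "norm q < 1" for q
  proof -
    have "norm (q ^ k) < 1"
      using that assms(2) by (simp add: norm_power power_less_one_iff)
    hence "(\<lambda>n. f $ n * (q ^ k) ^ n) sums eval_fps f (q ^ k)"
      using assms(1) by (intro sums_eval_fps less_fps_conv_radius)
    hence "(\<lambda>n. dil k f $ (k * n) * q ^ (k * n)) sums eval_fps f (q ^ k)"
      using assms(2) by (simp add: dil_nth power_mult)
    thus ?thesis
      by (subst (asm) sums_mono_reindex)
         (use assms(2) in \<open>auto simp: strict_mono_def dil_nth elim!: dvdE\<close>)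
  qed
  show "fps_conv_radius (dil k f) \<ge> 1"
    unfolding fps_conv_radius_def
    by (rule conv_radius_geI_ex') (use sums in \<open>auto simp: sums_iff\<close>)
  show "eval_fps (dil k f) q = eval_fps f (q ^ k)" if "norm q < 1"
    using sums[OF that] by (simp add: eval_fps_def sums_iff)
qed

section \<open>The infinite product at a complex number\<close>

lemma convergent_prod_1_minus_power:
  assumes "norm (q :: complex) < 1"
  shows "convergent_prod (\<lambda>n. 1 - q ^ (n + 1))"
proof -
  have "summable (\<lambda>n. norm q * norm q ^ n)"
    using assms by (intro summable_mult summable_geometric) simp
  hence "abs_convergent_prod (\<lambda>n. 1 - q ^ (n + 1))"
    by (simp add: abs_convergent_prod_conv_summable norm_mult norm_power)
  thus ?thesis by (rule abs_convergent_prod_imp_convergent_prod)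
qed

lemma prodinf_1_minus_power_nonzero:
  assumes "norm (q :: complex) < 1"
  shows "(\<Prod>n. 1 - q ^ (n + 1)) \<noteq> 0"
proof (rule prodinf_nonzero[OF convergent_prod_1_minus_power[OF assms]])
  fix n
  have "norm (q ^ (n + 1)) < 1"
    using assms by (simp add: norm_power power_less_one_iff del: power_Suc)
  thus "1 - q ^ (n + 1) \<noteq> 0" by auto
qed

text \<open>\<open>pentagonal\<close> increases along 0, 1, -1, 2, -2, and so on. Hence the right
  side of the finite identity is a partial sum of the power series.\<close>

lemma atLeastAtMost_eq_pentagonal_le:
  "{- int n..int n} = {m. pentagonal m \<le> pentagonal (- int n)}"
proof -
  have iff: "pentagonal m \<le> pentagonal (- int n) \<longleftrightarrow> \<bar>m\<bar> \<le> int n" for m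
  proof -
    have "m * (3 * m - 1) \<le> int n * (3 * int n + 1) \<longleftrightarrow> \<bar>m\<bar> \<le> int n"
    proof
      assume m: "\<bar>m\<bar> \<le> int n"
      have "m * (3 * m - 1) \<le> \<bar>m\<bar> * (3 * \<bar>m\<bar> + 1)"
        by (cases "m \<ge> 0") (simp_all add: algebra_simps)
      also have "\<dots> \<le> int n * (3 * int n + 1)"
        using m by (intro mult_mono) auto
      finally show "m * (3 * m - 1) \<le> int n * (3 * int n + 1)" .
    next
      assume le: "m * (3 * m - 1) \<le> int n * (3 * int n + 1)"
      show "\<bar>m\<bar> \<le> int n"
      proof (rule ccontr)
        assume "\<not> \<bar>m\<bar> \<le> int n"
        hence m: "int n + 1 \<le> \<bar>m\<bar>" by simp
        have "int n * (3 * int n + 1) < (int n + 1) * (3 * (int n + 1) - 1)"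
          by (simp add: algebra_simps)
        also have "\<dots> \<le> \<bar>m\<bar> * (3 * \<bar>m\<bar> - 1)"
          using m by (intro mult_mono) auto
        also have "\<dots> \<le> m * (3 * m - 1)"
          by (cases "m \<ge> 0") (simp_all add: algebra_simps)
        finally show False using le by simp
      qed
    qed
    moreover have "pentagonal m \<le> pentagonal (- int n)
        \<longleftrightarrow> 2 * int (pentagonal m) \<le> 2 * int (pentagonal (- int n))" by simp
    moreover have "- int n * (3 * - int n - 1) = int n * (3 * int n + 1)"
      by (simp add: algebra_simps)
    ultimately show ?thesis by (simp only: int_pentagonal)
  qed
  show ?thesis unfolding iff by auto
qed

text \<open>X-adic convergence says nothing about values. The finite pentagonal identity is used
  again, now at a complex \<open>q\<close>: its term k = 0 is the partial product, the sum of the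
  others tends to 0, and the right side is a partial sum of the series.\<close>

lemma eval_eta_fps:
  assumes "norm q < 1"
  shows "eval_fps eta_fps q = (\<Prod>n. 1 - q ^ (n + 1))"
proof -
  define r where "r = norm q"
  \<comment> \<open>Bounds all the products over k < i \<le> n at once, through 1 + r^i \<le> exp
    (r^i) and the geometric series.\<close>
  define C where "C = exp (1 / (1 - r))"
  have r: "0 \<le> r" "r < 1" using assms by (simp_all add: r_def)
  define P where "P n = (\<Prod>i\<in>{0<..n}. 1 - q ^ i)" for n
  define T where "T n k = (-1) ^ k * (\<Prod>i\<in>{k<..n}. 1 - q ^ i) * q ^ (k * n + \<Sum>{..k})" for n k
  have "(\<lambda>n. \<Prod>i\<le>n. 1 - q ^ (i + 1)) \<longlonglongrightarrow> (\<Prod>n. 1 - q ^ (n + 1))"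
    by (rule convergent_prod_LIMSEQ[OF convergent_prod_1_minus_power[OF assms]])
  hence "(\<lambda>n. \<Prod>i<n. 1 - q ^ (i + 1)) \<longlonglongrightarrow> (\<Prod>n. 1 - q ^ (n + 1))"
    by (simp only: LIMSEQ_lessThan_iff_atMost)
  moreover have "(\<Prod>i<n. 1 - q ^ (i + 1)) = P n" for n
    unfolding P_def
    by (rule prod.reindex_bij_witness[of _ "\<lambda>i. i - 1" "\<lambda>i. i + 1"]) auto
  ultimately have lim_P: "P \<longlonglongrightarrow> (\<Prod>n. 1 - q ^ (n + 1))" by simp
  have bound: "norm (T n k) \<le> C * r ^ n" if "k \<in> {0<..n}" for n k
  proof -
    have "norm (\<Prod>i\<in>{k<..n}. 1 - q ^ i) \<le> (\<Prod>i\<in>{k<..n}. exp (r ^ i))"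
      unfolding prod_norm[symmetric]
    proof (intro prod_mono conjI norm_ge_zero)
      fix i
      have "norm (1 - q ^ i) \<le> 1 + r ^ i"
        using norm_triangle_ineq4[of 1 "q ^ i"] by (simp add: norm_power r_def)
      also have "\<dots> \<le> exp (r ^ i)" by (rule exp_ge_add_one_self)
      finally show "norm (1 - q ^ i) \<le> exp (r ^ i)" .
    qed
    also have "\<dots> = exp (\<Sum>i\<in>{k<..n}. r ^ i)" by (simp add: exp_sum)
    also have "\<dots> \<le> C"
    proof -
      have "(\<Sum>i\<in>{k<..n}. r ^ i) \<le> (\<Sum>i. r ^ i)"
        using r by (intro sum_le_suminf summable_geometric) auto
      thus ?thesis using r by (simp add: C_def suminf_geometric)
    qed
    finally have "norm (\<Prod>i\<in>{k<..n}. 1 - q ^ i) \<le> C" .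
    moreover have "r ^ (k * n + \<Sum>{..k}) \<le> r ^ n"
      using r that by (intro power_decreasing) (auto simp: trans_le_add1)
    ultimately show ?thesis
      using r unfolding T_def norm_mult norm_power
      by (auto simp: r_def[symmetric] C_def intro!: mult_mono)
  qed
  have "(\<lambda>n. \<Sum>k\<in>{0<..n}. T n k) \<longlonglongrightarrow> 0"
  proof (rule Lim_null_comparison)
    show "\<forall>\<^sub>F n in sequentially. norm (\<Sum>k\<in>{0<..n}. T n k) \<le> C * (real n * r ^ n)"
    proof (rule always_eventually, rule allI)
      fix n
      have "norm (\<Sum>k\<in>{0<..n}. T n k) \<le> (\<Sum>k\<in>{0<..n}. C * r ^ n)"
        by (intro order.trans[OF norm_sum sum_mono] bound)
      thus "norm (\<Sum>k\<in>{0<..n}. T n k) \<le> C * (real n * r ^ n)" by (simp add: mult_ac)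
    qed
    have "(\<lambda>n. real n * r ^ n) \<longlonglongrightarrow> 0"
      using r by (intro powser_times_n_limit_0) simp
    thus "(\<lambda>n. C * (real n * r ^ n)) \<longlonglongrightarrow> 0"
      by (rule tendsto_mult_right_zero)
  qed
  with lim_P have "(\<lambda>n. P n + (\<Sum>k\<in>{0<..n}. T n k)) \<longlonglongrightarrow> (\<Prod>n. 1 - q ^ (n + 1)) + 0"
    by (rule tendsto_add)
  moreover have "P n + (\<Sum>k\<in>{0<..n}. T n k) = (\<Sum>k\<le>pentagonal (- int n). eta_fps $ k * q ^ k)" for n
  proof -
    have fin: "finite {m. pentagonal m \<le> pentagonal (- int n)}"
      by (simp flip: atLeastAtMost_eq_pentagonal_le)
    have "{..n} = insert 0 {0<..n}" by auto
    hence "P n + (\<Sum>k\<in>{0<..n}. T n k) = (\<Sum>k\<le>n. T n k)"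
      by (simp add: T_def P_def)
    also have "\<dots> = (\<Sum>m | pentagonal m \<le> pentagonal (- int n). sgn_parity m * q ^ pentagonal m)"
      unfolding T_def shanks_pentagonal atLeastAtMost_eq_pentagonal_le ..
    also have "\<dots> = (\<Sum>k\<le>pentagonal (- int n). \<Sum>m\<in>{m \<in> {m. pentagonal m \<le> pentagonal (- int n)}. pentagonal m = k}.
        sgn_parity m * q ^ pentagonal m)"
      by (rule sum.group[symmetric]) (use fin in auto)
    also have "\<dots> = (\<Sum>k\<le>pentagonal (- int n). eta_fps $ k * q ^ k)"
    proof (rule sum.cong)
      fix k assume "k \<in> {..pentagonal (- int n)}"
      hence "{m \<in> {m. pentagonal m \<le> pentagonal (- int n)}. pentagonal m = k} = {m. pentagonal m = k}" by auto
      thus "(\<Sum>m\<in>{m \<in> {m. pentagonal m \<le> pentagonal (- int n)}. pentagonal m = k}. sgn_parity m * q ^ pentagonal m)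
          = eta_fps $ k * q ^ k"
        by (simp add: eta_fps_nth_pentagonal sum_distrib_right)
    qed simp
    finally show ?thesis .
  qed
  moreover have "(\<lambda>n. \<Sum>k\<le>pentagonal (- int n). eta_fps $ k * q ^ k) \<longlonglongrightarrow> eval_fps eta_fps q"
  proof (rule filterlim_compose[of _ _ sequentially])
    have "summable (\<lambda>k. eta_fps $ k * q ^ k)"
      using assms fps_conv_radius_eta by (intro summable_fps less_fps_conv_radius)
    thus "(\<lambda>N. \<Sum>k\<le>N. eta_fps $ k * q ^ k) \<longlonglongrightarrow> eval_fps eta_fps q"
      unfolding eval_fps_def by (rule summable_LIMSEQ')
    show "filterlim (\<lambda>n. pentagonal (- int n)) sequentially sequentially"
    proof (rule filterlim_at_top_mono[OF filterlim_ident])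
      have "n \<le> pentagonal (- int n)" for n using abs_le_pentagonal[of "- int n"] by simp
      thus "\<forall>\<^sub>F n in sequentially. n \<le> pentagonal (- int n)" by simp
    qed
  qed
  ultimately show ?thesis by (simp add: LIMSEQ_unique)
qed

lemma eval_eta_septic:
  assumes "norm q < 1"
  shows "eval_fps eta_septic q = eval_fps eta_fps q * eval_fps eta_fps (q ^ 7)"
    and "fps_conv_radius eta_septic \<ge> 1"
proof -
  note dil7 = eval_fps_dil[OF fps_conv_radius_eta, of 7, simplified]
  show "eval_fps eta_septic q = eval_fps eta_fps q * eval_fps eta_fps (q ^ 7)"
    unfolding eta_septic_def using assms fps_conv_radius_eta dil7
    by (subst eval_fps_mult) (simp_all add: less_fps_conv_radius)
  show "fps_conv_radius eta_septic \<ge> 1"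
    unfolding eta_septic_def
    by (intro fps_conv_radius_mult_ge_1 fps_conv_radius_eta dil7)
qed

lemma eval_fps_cube_root_Delta47:
  assumes "norm q < 1"
  defines "a \<equiv> eval_fps eta_septic q" and "b \<equiv> eval_fps eta_septic (q ^ 2)"
  shows "eval_fps (fps_cube_root Delta47_cube_fps) q * b = a ^ 5 + 4 * q * a ^ 2 * b ^ 3"
proof -
  have conv_power: "fps_conv_radius (f ^ n) \<ge> 1" if "fps_conv_radius f \<ge> 1" for f :: "complex fps" and n
    using order.trans[OF that fps_conv_radius_power] .
  note conv_mult = fps_conv_radius_mult_ge_1
  have lt: "norm q < fps_conv_radius f" if "fps_conv_radius f \<ge> 1" for f :: "complex fps"
    using that assms(1) by (rule less_fps_conv_radius)
  have conv: "fps_conv_radius eta_septic \<ge> 1" "fps_conv_radius (dil 2 eta_septic) \<ge> 1"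
    "fps_conv_radius (fps_cube_root Delta47_cube_fps) \<ge> 1" "fps_conv_radius (4 * fps_X :: complex fps) \<ge> 1"
    unfolding fps_cube_root_Delta47_eq
    using eval_eta_septic(2)[OF assms(1)] fps_conv_radius_theta7
    by (auto intro!: conv_mult conv_power eval_fps_dil(1))
  have b: "eval_fps (dil 2 eta_septic) q = b"
    unfolding b_def by (rule eval_fps_dil(2)) (use conv assms(1) in auto)
  have X: "eval_fps (4 * fps_X) q = 4 * q"
    by (subst eval_fps_mult) auto
  have "eval_fps (fps_cube_root Delta47_cube_fps * dil 2 eta_septic) q
      = eval_fps (eta_septic ^ 5 + 4 * fps_X * eta_septic ^ 2 * dil 2 eta_septic ^ 3) q"
    by (simp only: fps_cube_root_Delta47_mult)
  also have "\<dots> = a ^ 5 + 4 * q * a ^ 2 * b ^ 3"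
    by (simp only: eval_fps_add eval_fps_mult eval_fps_power lt conv_mult conv_power conv b X a_def)
  finally have "eval_fps (fps_cube_root Delta47_cube_fps * dil 2 eta_septic) q
      = a ^ 5 + 4 * q * a ^ 2 * b ^ 3" .
  thus ?thesis by (simp only: eval_fps_mult lt conv b)
qed

theorem mainTheorem4:
  fixes z :: complex
  assumes "Im z > 0"
  shows "Delta47 z =
           dedekind_eta z ^ 5 * dedekind_eta (7 * z) ^ 5
             / (dedekind_eta (2 * z) * dedekind_eta (14 * z))
           + 4 * dedekind_eta z ^ 2 * dedekind_eta (2 * z) ^ 2
               * dedekind_eta (7 * z) ^ 2 * dedekind_eta (14 * z) ^ 2"
proof -
  define q where "q = nome z"
  \<comment> \<open>With this 24th root of q, eta at k z is x^k times an Euler product. The two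
    summands carry x to the powers 5 + 35 - 2 - 14 = 24 and 2 (1 + 2 + 7 + 14) = 48, that is, q and
    q^2.\<close>
  define x where "x = exp (2 * of_real pi * \<i> * z / 24)"
  define E where "E y = (\<Prod>n. 1 - y ^ (n + 1))" for y :: complex
  have q: "norm q < 1" using assms by (simp add: q_def nome_def)
  have x: "x \<noteq> 0" "x ^ 24 = q"
    by (simp_all add: x_def q_def nome_def exp_of_nat_mult[symmetric] mult_ac)
  have eta: "dedekind_eta (of_nat k * z) = x ^ k * E (q ^ k)" for k
  proof -
    have "nome (of_nat k * z) = q ^ k" "exp (2 * of_real pi * \<i> * (of_nat k * z) / 24) = x ^ k"
      by (simp_all add: nome_def q_def x_def exp_of_nat_mult[symmetric] mult_ac)
    thus ?thesis by (simp only: dedekind_eta_def E_def)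
  qed
  have lt: "norm (q ^ k) < 1" if "k > 0" for k
    using q that by (simp add: norm_power power_less_one_iff)
  define a b c d where "a = E q" and "b = E (q ^ 2)" and "c = E (q ^ 7)" and "d = E (q ^ 14)"
  have etas: "dedekind_eta z = x * a" "dedekind_eta (2 * z) = x ^ 2 * b"
    "dedekind_eta (7 * z) = x ^ 7 * c" "dedekind_eta (14 * z) = x ^ 14 * d"
    using eta[of 1] eta[of 2] eta[of 7] eta[of 14] by (simp_all add: a_def b_def c_def d_def)
  have nz: "b \<noteq> 0" "d \<noteq> 0"
    unfolding b_def d_def E_def by (rule prodinf_1_minus_power_nonzero, rule lt, simp)+
  have "eval_fps eta_septic q = a * c" "eval_fps eta_septic (q ^ 2) = b * d"
    using q lt[of 2] lt[of 7] lt[of 14]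
    by (simp_all add: eval_eta_septic eval_eta_fps a_def b_def c_def d_def E_def flip: power_mult)
  with eval_fps_cube_root_Delta47[OF q]
  have g: "eval_fps (fps_cube_root Delta47_cube_fps) q * (b * d)
      = (a * c) ^ 5 + 4 * q * (a * c) ^ 2 * (b * d) ^ 3" by simp
  have "Delta47 z * (b * d) = q * (eval_fps (fps_cube_root Delta47_cube_fps) q * (b * d))"
    by (simp add: Delta47_def q_def)
  also have "\<dots> = x ^ 24 * ((a * c) ^ 5 + 4 * x ^ 24 * (a * c) ^ 2 * (b * d) ^ 3)"
    unfolding g x(2) ..
  also have "\<dots> = ((x * a) ^ 5 * (x ^ 7 * c) ^ 5 / (x ^ 2 * b * (x ^ 14 * d))
      + 4 * (x * a) ^ 2 * (x ^ 2 * b) ^ 2 * (x ^ 7 * c) ^ 2 * (x ^ 14 * d) ^ 2) * (b * d)"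
  proof -
    have "(x * a) ^ 5 * (x ^ 7 * c) ^ 5 * (b * d) = x ^ 24 * (a * c) ^ 5 * (x ^ 2 * b * (x ^ 14 * d))"
      by algebra
    hence "(x * a) ^ 5 * (x ^ 7 * c) ^ 5 / (x ^ 2 * b * (x ^ 14 * d)) * (b * d) = x ^ 24 * (a * c) ^ 5"
      using nz x(1) by (simp add: divide_eq_eq)
    moreover have "4 * (x * a) ^ 2 * (x ^ 2 * b) ^ 2 * (x ^ 7 * c) ^ 2 * (x ^ 14 * d) ^ 2 * (b * d)
        = x ^ 24 * (4 * x ^ 24 * (a * c) ^ 2 * (b * d) ^ 3)"
      by algebra
    ultimately show ?thesis by (simp only: distrib_left distrib_right)
  qed
  finally show ?thesis unfolding etas using nz by simp
qed

end
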